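(* Let $Q$ be trace class, let $v_0\in L_2(\Omega,L_2(\mathcal{O}))$ be $\mathcal{F}_0$-measurable, and let $f:L_2(\mathcal{O})\to L_2(\mathcal{O})$ satisfy $\|f(x_1)-f(x_2)\|\le K_f\|x_1-x_2\|$ for all $x_1,x_2\in L_2(\mathcal{O})$ and, for some $\beta\in[0,1]$ and some constant $C_f$, the growth condition $\|A^{(\beta-1)/2}f(x)\|\le C_f\|x\|$ for all $x\in L_2(\mathcal{O})$. Let $(u,v)$ be the mild solution of the stochastic coupled parabolic-elliptic system $$\begin{cases} dv-\Delta v\,dt=f(u)\,dt+dW & \text{in }(0,\infty)\times\mathcal{O},\\ v=u-\Delta u & \text{in }(0,\infty)\times\mathcal{O},\\ v=u=0 & \text{on }(0,\infty)\times\partial\mathcal{O},\\ v(0,\cdot)=v_0 & \text{in }\mathcal{O},\end{cases}$$ and let $T>0$. Then for $0\le\gamma<\beta\le1$ there is a constant $C$, independent of $t_1,t_2$, such that $$\mathbb{E}\|u(t_2)-u(t_1)\|^2\le C(t_2-t_1)^{\gamma},\qquad 0\le t_1\le t_2\le T.$$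
   Context: $\mathcal{O}\subset\mathbb{R}^d$, $d\in\{1,2,3\}$, is a bounded convex polygonal domain (interval, polygon, polyhedron); $H=L_2(\mathcal{O})$ with norm $\|\cdot\|$. $A=-\Delta$ with $D(A)=H^2(\mathcal{O})\cap H^1_0(\mathcal{O})$; its real powers are defined spectrally. $\{E(t)\}_{t\ge0}$ is the $C_0$-semigroup on $H$ generated by $-A$. $(\Omega,\mathcal{F},\{\mathcal{F}_t\}_{t\ge0},\mathbb{P})$ is a filtered probability space satisfying the usual conditions, and $\{W(t)\}_{t\ge0}$ is an $H$-valued Wiener process with respect to $\{\mathcal{F}_t\}$, with covariance operator $Q$ (self-adjoint, positive semidefinite). Mild solution: $u(t)=(I+A)^{-1}v(t)$, where $\{v(t)\}_{t\ge0}$ is the $\mathcal{F}_t$-adapted $H$-valued process satisfying $\mathbb{P}$-a.s., for $t\ge0$, $v(t)=E(t)v_0+\int_0^tE(t-\tau)f(u(\tau))\,d\tau+\int_0^tE(t-\tau)\,dW(\tau)$. *)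

theory Defs
  imports "HOL-Probability.Probability"
begin

section \<open>Domain and Sobolev spaces\<close>

definition convex_polytopal_domain :: "'a::euclidean_space set \<Rightarrow> bool" where
  "convex_polytopal_domain D \<longleftrightarrow> D \<noteq> {} \<and> (\<exists>P. polytope P \<and> D = interior P)"

text \<open>Functions on \<open>D\<close> are total functions of which only the values on \<open>D\<close> matter, up to null
  sets.\<close>

definition square_integrable :: "'a::euclidean_space set \<Rightarrow> ('a \<Rightarrow> real) \<Rightarrow> bool" where
  "square_integrable D g \<longleftrightarrow>
     g \<in> borel_measurable (lebesgue_on D) \<and> integrable (lebesgue_on D) (\<lambda>\<xi>. (g \<xi>)\<^sup>2)"

definition partial :: "'a::euclidean_space \<Rightarrow> ('a \<Rightarrow> real) \<Rightarrow> 'a \<Rightarrow> real" where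
  "partial i g \<xi> = frechet_derivative g (at \<xi>) i"

primrec C_k :: "nat \<Rightarrow> ('a::euclidean_space \<Rightarrow> real) \<Rightarrow> bool" where
  "C_k 0 g \<longleftrightarrow> continuous_on UNIV g"
| "C_k (Suc k) g \<longleftrightarrow> (\<forall>\<xi>. g differentiable (at \<xi>)) \<and> (\<forall>i\<in>Basis. C_k k (partial i g))"

definition test_function :: "'a::euclidean_space set \<Rightarrow> ('a \<Rightarrow> real) \<Rightarrow> bool" where
  "test_function D \<phi> \<longleftrightarrow>
     (\<forall>k. C_k k \<phi>) \<and> compact (closure {\<xi>. \<phi> \<xi> \<noteq> 0}) \<and> closure {\<xi>. \<phi> \<xi> \<noteq> 0} \<subseteq> D"

text \<open>\<open>w\<close> is the weak derivative of \<open>g\<close> in direction \<open>i\<close>, both square integrable.\<close>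

definition weak_partial ::
    "'a::euclidean_space set \<Rightarrow> 'a \<Rightarrow> ('a \<Rightarrow> real) \<Rightarrow> ('a \<Rightarrow> real) \<Rightarrow> bool" where
  "weak_partial D i g w \<longleftrightarrow> square_integrable D g \<and> square_integrable D w \<and>
     (\<forall>\<phi>. test_function D \<phi> \<longrightarrow>
        (\<integral>\<xi>. g \<xi> * partial i \<phi> \<xi> \<partial>lebesgue_on D) = - (\<integral>\<xi>. w \<xi> * \<phi> \<xi> \<partial>lebesgue_on D))"

definition sobolev_H1 :: "'a::euclidean_space set \<Rightarrow> ('a \<Rightarrow> real) set" where
  "sobolev_H1 D = {g. \<forall>i\<in>Basis. \<exists>w. weak_partial D i g w}"

definition sobolev_H2 :: "'a::euclidean_space set \<Rightarrow> ('a \<Rightarrow> real) set" where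
  "sobolev_H2 D = {g. \<forall>i\<in>Basis. \<exists>w\<in>sobolev_H1 D. weak_partial D i g w}"

text \<open>The closure of the test functions in the norm of \<open>H\<^sup>1\<close>.\<close>

definition sobolev_H10 :: "'a::euclidean_space set \<Rightarrow> ('a \<Rightarrow> real) set" where
  "sobolev_H10 D = {g. \<exists>w \<phi>. (\<forall>i\<in>Basis. weak_partial D i g (w i)) \<and> (\<forall>n. test_function D (\<phi> n)) \<and>
     (\<lambda>n. \<integral>\<xi>. (\<phi> n \<xi> - g \<xi>)\<^sup>2 \<partial>lebesgue_on D) \<longlonglongrightarrow> 0 \<and>
     (\<forall>i\<in>Basis. (\<lambda>n. \<integral>\<xi>. (partial i (\<phi> n) \<xi> - w i \<xi>)\<^sup>2 \<partial>lebesgue_on D) \<longlonglongrightarrow> 0)}"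

definition weak_laplacian :: "'a::euclidean_space set \<Rightarrow> ('a \<Rightarrow> real) \<Rightarrow> ('a \<Rightarrow> real) \<Rightarrow> bool" where
  "weak_laplacian D g l \<longleftrightarrow>
     (\<exists>w z. (\<forall>i\<in>Basis. weak_partial D i g (w i) \<and> weak_partial D i (w i) (z i)) \<and>
            (AE \<xi> in lebesgue_on D. l \<xi> = (\<Sum>i\<in>Basis. z i \<xi>)))"


section \<open>The space of square integrable functions as a type\<close>

text \<open>There are no types depending on the set \<open>D\<close>. The space \<open>L\<^sub>2(D)\<close> is therefore a type \<open>'h\<close> of
  class \<open>real_inner\<close> together with a map \<open>J\<close> that sends each vector to one of its representatives;
  the conditions say that \<open>J\<close> induces an isometric isomorphism from \<open>'h\<close> onto the square integrable
  functions on \<open>D\<close> modulo equality almost everywhere. Completeness and separability of \<open>'h\<close>, which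
  are consequences, are type class constraints where the Bochner integral needs them.\<close>

definition is_L2 :: "'a::euclidean_space set \<Rightarrow> ('h::real_inner \<Rightarrow> 'a \<Rightarrow> real) \<Rightarrow> bool" where
  "is_L2 D J \<longleftrightarrow>
     (\<forall>x. square_integrable D (J x)) \<and>
     (\<forall>x y. AE \<xi> in lebesgue_on D. J (x + y) \<xi> = J x \<xi> + J y \<xi>) \<and>
     (\<forall>c x. AE \<xi> in lebesgue_on D. J (c *\<^sub>R x) \<xi> = c * J x \<xi>) \<and>
     (\<forall>x y. x \<bullet> y = (\<integral>\<xi>. J x \<xi> * J y \<xi> \<partial>lebesgue_on D)) \<and>
     (\<forall>g. square_integrable D g \<longrightarrow> (\<exists>x. AE \<xi> in lebesgue_on D. J x \<xi> = g \<xi>))"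


section \<open>Operators\<close>

text \<open>Unbounded operators are represented by their graphs.\<close>

definition dirichlet_op ::
    "'a::euclidean_space set \<Rightarrow> ('h::real_inner \<Rightarrow> 'a \<Rightarrow> real) \<Rightarrow> ('h \<times> 'h) set" where
  "dirichlet_op D J =
     {(x, y). J x \<in> sobolev_H2 D \<inter> sobolev_H10 D \<and> weak_laplacian D (J x) (J (- y))}"

definition id_plus :: "('h::real_inner \<times> 'h) set \<Rightarrow> ('h \<times> 'h) set" where
  "id_plus A = {(x, x + y) | x y. (x, y) \<in> A}"

definition orthonormal_basis :: "(nat \<Rightarrow> 'h::real_inner) \<Rightarrow> bool" where
  "orthonormal_basis e \<longleftrightarrow>
     (\<forall>m n. e m \<bullet> e n = (if m = n then 1 else 0)) \<and> closure (span (range e)) = UNIV"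

definition eigenbasis ::
    "('h::real_inner \<times> 'h) set \<Rightarrow> (nat \<Rightarrow> 'h) \<Rightarrow> (nat \<Rightarrow> real) \<Rightarrow> bool" where
  "eigenbasis A e \<mu> \<longleftrightarrow>
     orthonormal_basis e \<and> (\<forall>n. 0 < \<mu> n \<and> (e n, \<mu> n *\<^sub>R e n) \<in> A)"

text \<open>The graph of \<open>A\<^sup>s\<close>, defined spectrally: \<open>A\<^sup>s x = (\<Sum>n. \<mu>\<^sub>n\<^sup>s \<langle>x, e\<^sub>n\<rangle> e\<^sub>n)\<close> for those \<open>x\<close> for which the
  series converges. It does not depend on the choice of the eigenbasis.\<close>

definition op_powr :: "('h::real_inner \<times> 'h) set \<Rightarrow> real \<Rightarrow> ('h \<times> 'h) set" where
  "op_powr A s =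
     {(x, y). \<exists>e \<mu>. eigenbasis A e \<mu> \<and> (\<lambda>n. (\<mu> n powr s * (x \<bullet> e n)) *\<^sub>R e n) sums y}"

definition C0_semigroup :: "(real \<Rightarrow> 'h::real_normed_vector \<Rightarrow> 'h) \<Rightarrow> bool" where
  "C0_semigroup E \<longleftrightarrow>
     (\<forall>t\<ge>0. bounded_linear (E t)) \<and> E 0 = id \<and>
     (\<forall>s\<ge>0. \<forall>t\<ge>0. E (s + t) = E s \<circ> E t) \<and>
     (\<forall>x. ((\<lambda>t. E t x) \<longlongrightarrow> x) (at_right 0))"

definition generator :: "(real \<Rightarrow> 'h::real_normed_vector \<Rightarrow> 'h) \<Rightarrow> ('h \<times> 'h) set" where
  "generator E = {(x, y). ((\<lambda>t. (E t x - x) /\<^sub>R t) \<longlongrightarrow> y) (at_right 0)}"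

definition generated_by_minus ::
    "('h::real_normed_vector \<times> 'h) set \<Rightarrow> (real \<Rightarrow> 'h \<Rightarrow> 'h) \<Rightarrow> bool" where
  "generated_by_minus A E \<longleftrightarrow> C0_semigroup E \<and> generator E = {(x, - y) | x y. (x, y) \<in> A}"

definition positive_op :: "('h::real_inner \<Rightarrow> 'h) \<Rightarrow> bool" where
  "positive_op Q \<longleftrightarrow>
     bounded_linear Q \<and> (\<forall>x y. Q x \<bullet> y = x \<bullet> Q y) \<and> (\<forall>x. 0 \<le> Q x \<bullet> x)"

text \<open>The trace of a positive operator, in \<open>[0, \<infinity>]\<close>; its value is the same for all orthonormal
  bases.\<close>

definition pos_trace :: "('h::real_inner \<Rightarrow> 'h) \<Rightarrow> ennreal" where
  "pos_trace S = (let b = (SOME b. orthonormal_basis b) in \<Sum>k. ennreal (S (b k) \<bullet> b k))"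

definition pos_trace_class :: "('h::real_inner \<Rightarrow> 'h) \<Rightarrow> bool" where
  "pos_trace_class Q \<longleftrightarrow> positive_op Q \<and> pos_trace Q < \<infinity>"


section \<open>Wiener processes and the stochastic convolution\<close>

text \<open>Time runs over \<open>[0, \<infinity>)\<close>: families indexed by reals are constrained and used for nonnegative
  indices only.\<close>

definition usual_filtration :: "'w measure \<Rightarrow> (real \<Rightarrow> 'w measure) \<Rightarrow> bool" where
  "usual_filtration M F \<longleftrightarrow>
     (\<forall>t\<ge>0. subalgebra M (F t)) \<and>
     (\<forall>s t. 0 \<le> s \<and> s \<le> t \<longrightarrow> subalgebra (F t) (F s)) \<and>
     complete_measure M \<and> null_sets M \<subseteq> sets (F 0) \<and>
     (\<forall>t\<ge>0. sets (F t) = (\<Inter>s\<in>{t<..}. sets (F s)))"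

definition centered_gaussian :: "real \<Rightarrow> real measure" where
  "centered_gaussian var =
     (if var = 0 then return borel 0 else density lborel (normal_density 0 (sqrt var)))"

definition wiener_process ::
    "'w measure \<Rightarrow> (real \<Rightarrow> 'w measure) \<Rightarrow> ('h::real_inner \<Rightarrow> 'h) \<Rightarrow> (real \<Rightarrow> 'w \<Rightarrow> 'h) \<Rightarrow> bool" where
  "wiener_process M F Q W \<longleftrightarrow>
     (\<forall>t\<ge>0. W t \<in> borel_measurable (F t)) \<and>
     (AE \<omega> in M. W 0 \<omega> = 0) \<and>
     (AE \<omega> in M. continuous_on {0..} (\<lambda>t. W t \<omega>)) \<and>
     (\<forall>s t. 0 \<le> s \<and> s \<le> t \<longrightarrow>
        prob_space.indep_set M (sets (F s))
          (sets (vimage_algebra (space M) (\<lambda>\<omega>. W t \<omega> - W s \<omega>) borel)) \<and>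
        (\<forall>h. distr M borel (\<lambda>\<omega>. (W t \<omega> - W s \<omega>) \<bullet> h) =
               centered_gaussian ((t - s) * (Q h \<bullet> h))))"

text \<open>A step function from \<open>[s 0, s n]\<close> to the bounded operators, with value \<open>B i\<close> on
  \<open>(s i, s (i + 1)]\<close>, and its integral with respect to \<open>W\<close>.\<close>

definition is_step :: "real \<Rightarrow> nat \<Rightarrow> (nat \<Rightarrow> real) \<Rightarrow> (nat \<Rightarrow> 'h::real_normed_vector \<Rightarrow> 'h) \<Rightarrow> bool" where
  "is_step t n s B \<longleftrightarrow>
     s 0 = 0 \<and> s n = t \<and> (\<forall>i<n. s i \<le> s (Suc i) \<and> bounded_linear (B i))"

definition step_op ::
    "nat \<Rightarrow> (nat \<Rightarrow> real) \<Rightarrow> (nat \<Rightarrow> 'h::real_normed_vector \<Rightarrow> 'h) \<Rightarrow> real \<Rightarrow> 'h \<Rightarrow> 'h" where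
  "step_op n s B \<tau> x = (\<Sum>i<n. indicator {s i<..s (Suc i)} \<tau> *\<^sub>R B i x)"

definition step_integral ::
    "(real \<Rightarrow> 'w \<Rightarrow> 'h::real_normed_vector) \<Rightarrow> nat \<Rightarrow> (nat \<Rightarrow> real) \<Rightarrow> (nat \<Rightarrow> 'h \<Rightarrow> 'h) \<Rightarrow> 'w \<Rightarrow> 'h" where
  "step_integral W n s B \<omega> = (\<Sum>i<n. B i (W (s (Suc i)) \<omega> - W (s i) \<omega>))"

text \<open>\<open>X\<close> is a version of \<open>\<integral>\<^sub>0\<^sup>t \<Phi>(\<tau>) dW(\<tau>)\<close> for a deterministic strongly measurable operator-valued
  integrand \<open>\<Phi>\<close>: the extension by the Ito isometry of the integral of step functions. The squared
  norm of the integrand is \<open>\<integral>\<^sub>0\<^sup>t \<parallel>\<Phi>(\<tau>) Q\<^sup>1\<^sup>/\<^sup>2\<parallel>\<^sup>2 d\<tau>\<close> with the Hilbert-Schmidt norm, where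
  \<open>\<parallel>S Q\<^sup>1\<^sup>/\<^sup>2\<parallel>\<^sup>2\<close> is the trace of \<open>S Q S\<^sup>*\<close>.\<close>

definition has_wiener_integral ::
    "'w measure \<Rightarrow> ('h::real_inner \<Rightarrow> 'h) \<Rightarrow> (real \<Rightarrow> 'w \<Rightarrow> 'h) \<Rightarrow>
     (real \<Rightarrow> 'h \<Rightarrow> 'h) \<Rightarrow> real \<Rightarrow> ('w \<Rightarrow> 'h) \<Rightarrow> bool" where
  "has_wiener_integral M Q W \<Phi> t X \<longleftrightarrow>
     (\<forall>x. (\<lambda>\<tau>. \<Phi> \<tau> x) \<in> borel_measurable (restrict_space borel {0..t})) \<and>
     X \<in> borel_measurable M \<and>
     (\<exists>n s B. (\<forall>k. is_step t (n k) (s k) (B k)) \<and>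
        (\<lambda>k. \<integral>\<^sup>+\<tau>\<in>{0..t}.
           (let S = (\<lambda>x. step_op (n k) (s k) (B k) \<tau> x - \<Phi> \<tau> x)
            in pos_trace (S \<circ> Q \<circ> adjoint S)) \<partial>lborel) \<longlonglongrightarrow> 0 \<and>
        (\<lambda>k. \<integral>\<^sup>+\<omega>. ennreal ((norm (step_integral W (n k) (s k) (B k) \<omega> - X \<omega>))\<^sup>2) \<partial>M) \<longlonglongrightarrow> 0)"

text \<open>The pair \<open>(u, v)\<close> is a mild solution. The process \<open>v\<close> is jointly measurable in time and event, and
  almost all paths of \<open>f(u)\<close> are locally Bochner integrable, so that the pathwise integral is
  meaningful. For each \<open>t\<close> the variable \<open>Z t\<close> is some version of the stochastic convolution at time
  \<open>t\<close>.\<close>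

definition mild_solution ::
    "'w measure \<Rightarrow> (real \<Rightarrow> 'w measure) \<Rightarrow>
     ('h::{real_inner, banach, second_countable_topology} \<times> 'h) set \<Rightarrow> (real \<Rightarrow> 'h \<Rightarrow> 'h) \<Rightarrow>
     ('h \<Rightarrow> 'h) \<Rightarrow> ('h \<Rightarrow> 'h) \<Rightarrow> (real \<Rightarrow> 'w \<Rightarrow> 'h) \<Rightarrow> ('w \<Rightarrow> 'h) \<Rightarrow>
     (real \<Rightarrow> 'w \<Rightarrow> 'h) \<Rightarrow> (real \<Rightarrow> 'w \<Rightarrow> 'h) \<Rightarrow> bool" where
  "mild_solution M F A E f Q W v0 u v \<longleftrightarrow>
     (\<forall>t\<ge>0. v t \<in> borel_measurable (F t)) \<and>
     (\<lambda>(t, \<omega>). v t \<omega>) \<in> borel_measurable (restrict_space borel {0..} \<Otimes>\<^sub>M M) \<and>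
     (\<forall>t\<ge>0. \<forall>\<omega>\<in>space M. (v t \<omega>, u t \<omega>) \<in> (id_plus A)\<inverse>) \<and>
     (\<exists>Z. (\<forall>t\<ge>0. has_wiener_integral M Q W (\<lambda>\<tau>. E (t - \<tau>)) t (Z t)) \<and>
        (AE \<omega> in M. \<forall>t\<ge>0.
           set_integrable lborel {0..t} (\<lambda>\<tau>. f (u \<tau> \<omega>)) \<and>
           v t \<omega> = E t (v0 \<omega>) + (LINT \<tau>:{0..t}|lborel. E (t - \<tau>) (f (u \<tau> \<omega>))) + Z t \<omega>))"

end

theory Submission
  imports Defs
begin

text \<open>The growth condition on \<open>f\<close> provides an eigenbasis \<open>e\<^sub>n\<close> of \<open>A\<close> with eigenvalues \<open>\<mu>\<^sub>n > 0\<close>.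
  In its coordinates \<open>E t\<close> acts as multiplication by \<open>exp (- \<mu>\<^sub>n t)\<close> and \<open>(I + A)\<^sup>-\<^sup>1\<close> as division by
  \<open>1 + \<mu>\<^sub>n\<close>, so \<open>\<parallel>u t2 - u t1\<parallel>\<^sup>2\<close> is the sum of the squared coordinates of \<open>v t2 - v t1\<close>, each divided by
  \<open>(1 + \<mu>\<^sub>n)\<^sup>2\<close>. This factor compensates \<open>\<bar>exp (- \<mu>\<^sub>n t2) - exp (- \<mu>\<^sub>n t1)\<bar> \<le> \<mu>\<^sub>n (t2 - t1)\<close>, and each of the
  three terms of \<open>v\<close> contributes \<open>O(t2 - t1)\<close> in mean square: the initial value directly, the drift by
  the Cauchy-Schwarz inequality, and the stochastic convolution by the Ito isometry in each
  coordinate, summed with \<open>\<Sum>\<^sub>n \<langle>Q e\<^sub>n, e\<^sub>n\<rangle> = tr Q\<close>. The drift needs \<open>\<E> \<integral> \<parallel>f(u)\<parallel>\<^sup>2 < \<infinity>\<close>. No moment of \<open>u\<close> is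
  assumed, so Gronwall's inequality is applied path by path before taking expectations. Since
  \<open>t2 - t1 \<le> T\<close>, the rate \<open>t2 - t1\<close> is at least as good as \<open>(t2 - t1)\<^sup>\<gamma>\<close>.\<close>

section \<open>Orthonormal bases\<close>

text \<open>Coordinates are chosen because all that is given about the operators becomes scalar
  there. Of \<open>E\<close> only the generator is known, and on eigenvectors it determines the
  exponentials. The stochastic convolution is given as a limit of integrals of operator-valued step
  functions, and pairing with \<open>e n\<close> turns these into sums of terms
  \<open>(W b - W a) \<bullet> h\<close>. The versions \<open>Z t1\<close> and \<open>Z t2\<close>
  come with unrelated approximating sequences, so their difference is not itself presented as an
  integral. It is controlled by comparing two scalar integrals with arbitrary kernels; this
  comparison replaces the isometry in the limit by an inequality with constant 4, which does not
  affect the rate. One kernel estimate serves drift and noise alike: both kernels are active on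
  \<open>[0, t1]\<close>, only the later one on \<open>[t1, t2]\<close>, which yields
  \<open>(t2 - t1)\<^sup>2 * t1 + (t2 - t1)\<close>. Second moments are estimated in
  \<open>ennreal\<close>, so that a bound can precede the proof of finiteness.\<close>

lemma orthonormal_basis_inner:
  assumes "orthonormal_basis e"
  shows "e m \<bullet> e n = (if m = n then 1 else 0)"
  using assms by (simp add: orthonormal_basis_def)

lemma inner_orthonormal_sum:
  assumes "orthonormal_basis e" "finite I"
  shows "(\<Sum>n\<in>I. c n *\<^sub>R e n) \<bullet> e m = (if m \<in> I then c m else 0)"
  using assms by (simp add: inner_sum_left orthonormal_basis_inner if_distrib cong: if_cong)

lemma norm_orthonormal_sum:
  assumes "orthonormal_basis e" "finite I"
  shows "(norm (\<Sum>n\<in>I. c n *\<^sub>R e n))\<^sup>2 = (\<Sum>n\<in>I. (c n)\<^sup>2)"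
proof -
  have "(norm (\<Sum>n\<in>I. c n *\<^sub>R e n))\<^sup>2 = (\<Sum>m\<in>I. c m * ((\<Sum>n\<in>I. c n *\<^sub>R e n) \<bullet> e m))"
    unfolding power2_norm_eq_inner by (simp add: inner_sum_right)
  also have "\<dots> = (\<Sum>n\<in>I. (c n)\<^sup>2)"
    by (intro sum.cong refl) (simp add: inner_orthonormal_sum[OF assms] power2_eq_square)
  finally show ?thesis .
qed

text \<open>The projection \<open>?p\<close> satisfies
  \<open>z \<bullet> ?p = (norm ?p)\<^sup>2\<close>, so subtracting it can only shorten
  \<open>z\<close>. The bound is uniform in \<open>I\<close>, which allows convergence of the
  expansion to be tested on a dense set.\<close>

lemma orthonormal_remainder_le:
  assumes "orthonormal_basis e" "finite I"
  shows "norm (z - (\<Sum>n\<in>I. (z \<bullet> e n) *\<^sub>R e n)) \<le> norm z"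
proof -
  let ?p = "\<Sum>n\<in>I. (z \<bullet> e n) *\<^sub>R e n"
  have zp: "z \<bullet> ?p = (norm ?p)\<^sup>2"
    unfolding norm_orthonormal_sum[OF assms]
    by (simp add: inner_sum_right power2_eq_square)
  have "(norm (z - ?p))\<^sup>2 = (norm z)\<^sup>2 - (norm ?p)\<^sup>2"
    using zp unfolding power2_norm_eq_inner by (simp add: inner_diff inner_commute)
  then have "(norm (z - ?p))\<^sup>2 \<le> (norm z)\<^sup>2"
    by simp
  then show ?thesis
    by (rule power2_le_imp_le) simp
qed

text \<open>On the span of the basis the partial sums are eventually exact. The span is dense and
  remainders do not increase norms, so an approximation \<open>y\<close> of \<open>x\<close> within
  \<open>r\<close> leaves an error below \<open>r\<close>.\<close>

lemma orthonormal_basis_sums: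
  fixes x :: "'h::real_inner"
  assumes e: "orthonormal_basis e"
  shows "(\<lambda>n. (x \<bullet> e n) *\<^sub>R e n) sums x"
  unfolding sums_def
proof (rule LIMSEQ_I)
  fix r :: real
  assume "r > 0"
  let ?P = "\<lambda>N z. \<Sum>n<N. (z \<bullet> e n) *\<^sub>R e n"
  have "x \<in> closure (span (range e))"
    using e by (simp add: orthonormal_basis_def)
  then obtain y where y: "y \<in> span (range e)" "dist y x < r"
    using \<open>r > 0\<close> by (auto simp: closure_approachable)
  have "\<exists>m. \<forall>N\<ge>m. ?P N y = y"
  proof (rule span_induct[OF y(1)])
    fix z assume "z \<in> range e"
    then obtain k where "z = e k" by auto
    then show "\<exists>m. \<forall>N\<ge>m. ?P N z = z"
      by (auto intro!: exI[of _ "Suc k"]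
          simp: orthonormal_basis_inner[OF e] if_distrib[of "\<lambda>a. a *\<^sub>R _"] cong: if_cong)
  next
    show "subspace {y. \<exists>m. \<forall>N\<ge>m. ?P N y = y}"
      unfolding subspace_def
    proof (intro conjI ballI allI)
      fix a b
      assume "a \<in> {y. \<exists>m. \<forall>N\<ge>m. ?P N y = y}" "b \<in> {y. \<exists>m. \<forall>N\<ge>m. ?P N y = y}"
      then obtain m m' where "\<And>N. N \<ge> m \<Longrightarrow> ?P N a = a" "\<And>N. N \<ge> m' \<Longrightarrow> ?P N b = b"
        by blast
      then have "\<forall>N\<ge>max m m'. ?P N (a + b) = a + b"
        by (simp add: inner_add_left scaleR_add_left sum.distrib)
      then show "a + b \<in> {y. \<exists>m. \<forall>N\<ge>m. ?P N y = y}" by blast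
    next
      fix c a
      assume "a \<in> {y. \<exists>m. \<forall>N\<ge>m. ?P N y = y}"
      moreover have "?P N (c *\<^sub>R a) = c *\<^sub>R ?P N a" for N
        by (simp add: scaleR_sum_right)
      ultimately show "c *\<^sub>R a \<in> {y. \<exists>m. \<forall>N\<ge>m. ?P N y = y}" by auto
    qed auto
  qed
  then obtain m where m: "\<And>N. N \<ge> m \<Longrightarrow> ?P N y = y"
    by blast
  show "\<exists>no. \<forall>N\<ge>no. norm (?P N x - x) < r"
  proof (intro exI allI impI)
    fix N assume "m \<le> N"
    then have "?P N x - x = - ((x - y) - ?P N (x - y))"
      using m[of N] by (simp add: inner_diff_left scaleR_diff_left sum_subtractf)
    then have "norm (?P N x - x) \<le> norm (x - y)"
      using orthonormal_remainder_le[OF e, of "{..<N}" "x - y"]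
      by (simp only: norm_minus_cancel finite_lessThan)
    with y(2) show "norm (?P N x - x) < r"
      by (simp add: dist_norm norm_minus_commute)
  qed
qed

lemma parseval_inner:
  fixes x y :: "'h::real_inner"
  assumes "orthonormal_basis e"
  shows "(\<lambda>n. (x \<bullet> e n) * (y \<bullet> e n)) sums (x \<bullet> y)"
  using bounded_linear.sums[OF bounded_linear_inner_left orthonormal_basis_sums[OF assms, of x], of y]
  by (simp add: inner_commute)

lemma parseval:
  fixes x :: "'h::real_inner"
  assumes "orthonormal_basis e"
  shows "(\<Sum>n. ennreal ((x \<bullet> e n)\<^sup>2)) = ennreal ((norm x)\<^sup>2)"
  using parseval_inner[OF assms, of x x]
  by (intro suminf_ennreal_eq) (auto simp: power2_eq_square power2_norm_eq_inner[symmetric] dot_square_norm)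

lemma inner_square_le_norm_square:
  assumes "orthonormal_basis e"
  shows "(x \<bullet> e n)\<^sup>2 \<le> (norm x)\<^sup>2"
proof -
  have "\<bar>x \<bullet> e n\<bar> \<le> norm x * norm (e n)"
    by (rule Cauchy_Schwarz_ineq2)
  moreover have "norm (e n) = 1"
    using orthonormal_basis_inner[OF assms, of n n] by (simp add: norm_eq_sqrt_inner)
  ultimately show ?thesis
    using abs_le_square_iff[of "x \<bullet> e n" "norm x"] by simp
qed

text \<open>By Pythagoras the Cauchy criterion for the vectors is the one for the squared
  coefficients; completeness of the space supplies the limit.\<close>

lemma summable_orthonormal:
  fixes b :: "nat \<Rightarrow> 'h::{real_inner, banach}"
  assumes b: "orthonormal_basis b" and c: "summable (\<lambda>n. (c n)\<^sup>2)"
  shows "summable (\<lambda>n. c n *\<^sub>R b n)"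
  unfolding summable_Cauchy
proof (intro allI impI)
  fix r :: real
  assume "r > 0"
  then have "r\<^sup>2 > 0" by simp
  then obtain N where N: "\<And>m n. m \<ge> N \<Longrightarrow> norm (\<Sum>k=m..<n. (c k)\<^sup>2) < r\<^sup>2"
    using c unfolding summable_Cauchy by blast
  show "\<exists>N. \<forall>m\<ge>N. \<forall>n. norm (\<Sum>k=m..<n. c k *\<^sub>R b k) < r"
  proof (intro exI allI impI)
    fix m n assume "N \<le> m"
    then have "(norm (\<Sum>k=m..<n. c k *\<^sub>R b k))\<^sup>2 < r\<^sup>2"
      using N[of m n] by (simp add: norm_orthonormal_sum[OF b])
    then show "norm (\<Sum>k=m..<n. c k *\<^sub>R b k) < r"
      using \<open>r > 0\<close> by (simp add: power2_less_imp_less)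
  qed
qed

text \<open>\<open>adjoint\<close> is defined by choice, so its characteristic identity holds only
  once some adjoint is exhibited. The candidate \<open>g y\<close> is the Riesz representative of
  \<open>\<lambda>x. S x \<bullet> y\<close>, written as a series in the basis.\<close>

lemma inner_adjoint:
  fixes S :: "'h::{real_inner, banach} \<Rightarrow> 'h"
  assumes S: "bounded_linear S" and b: "orthonormal_basis (b :: nat \<Rightarrow> 'h)"
  shows "S x \<bullet> y = x \<bullet> adjoint S y"
proof -
  interpret S: bounded_linear S by fact
  obtain K where K: "\<And>x. norm (S x) \<le> norm x * K" "K > 0"
    using S.pos_bounded by blast
  define c where "c y n = S (b n) \<bullet> y" for y n
  have cs: "summable (\<lambda>n. (c y n)\<^sup>2)" for y
  proof (rule bounded_imp_summable)
    fix n
    \<comment> \<open>Testing the functional at \<open>p\<close> itself bounds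
      \<open>norm p * norm p\<close> by \<open>norm p * (K * norm y)\<close>, hence the sums of
      squared coefficients by \<open>(K * norm y)\<^sup>2\<close>.\<close>
    define p where "p = (\<Sum>k\<le>n. c y k *\<^sub>R b k)"
    have np: "(norm p)\<^sup>2 = (\<Sum>k\<le>n. (c y k)\<^sup>2)"
      unfolding p_def by (rule norm_orthonormal_sum[OF b]) simp
    also have "\<dots> = S p \<bullet> y"
      by (simp add: p_def S.sum S.scaleR inner_sum_left c_def power2_eq_square)
    also have "\<dots> \<le> norm (S p) * norm y"
      by (rule norm_cauchy_schwarz)
    also have "\<dots> \<le> norm p * K * norm y"
      by (intro mult_right_mono K) simp
    finally have "norm p * norm p \<le> norm p * (K * norm y)"
      by (simp add: power2_eq_square mult_ac)
    then have "norm p \<le> K * norm y"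
      using K(2) by (cases "norm p = 0") auto
    then have "(norm p)\<^sup>2 \<le> (K * norm y)\<^sup>2"
      by (intro power_mono) auto
    then show "(\<Sum>k\<le>n. (c y k)\<^sup>2) \<le> (K * norm y)\<^sup>2"
      by (simp add: np)
  qed simp
  define g where "g y = (\<Sum>n. c y n *\<^sub>R b n)" for y
  have "S x \<bullet> y = x \<bullet> g y" for x y
  proof -
    have "(\<lambda>n. x \<bullet> (c y n *\<^sub>R b n)) sums (x \<bullet> g y)"
      unfolding g_def
      by (intro bounded_linear.sums[OF bounded_linear_inner_right] summable_sums
          summable_orthonormal[OF b cs])
    moreover have "(\<lambda>n. S ((x \<bullet> b n) *\<^sub>R b n) \<bullet> y) sums (S x \<bullet> y)"
      by (intro bounded_linear.sums[OF bounded_linear_inner_left] S.sums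
          orthonormal_basis_sums[OF b])
    ultimately show ?thesis
      by (simp add: S.scaleR c_def mult.commute sums_unique2)
  qed
  then have "\<forall>x y. S x \<bullet> y = x \<bullet> g y" by blast
  then have "\<forall>x y. S x \<bullet> y = x \<bullet> adjoint S y"
    unfolding adjoint_def by (rule someI[where P="\<lambda>f'. \<forall>x y. S x \<bullet> y = x \<bullet> f' y"])
  then show ?thesis by blast
qed

section \<open>Semigroups on eigenvectors of the generator\<close>

lemma exp_difference_quotient:
  "((\<lambda>t. (exp (- \<mu> * t) - 1) / t) \<longlongrightarrow> - \<mu>) (at_right (0::real))"
proof -
  have "((\<lambda>t. exp (- \<mu> * t)) has_field_derivative - \<mu>) (at_right (0::real))"
    by (auto intro!: derivative_eq_intros)
  then show ?thesis
    unfolding has_field_derivative_iff by simp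
qed

text \<open>Uniform boundedness from Baire's theorem. Continuity at \<open>0\<close> holds vector by
  vector only, so in \<open>V n\<close> the time interval shrinks while the bound grows: this makes
  the closed sets \<open>V n\<close> cover the space, and one of them contains a ball.\<close>

lemma C0_semigroup_bounded_near_0:
  fixes E :: "real \<Rightarrow> 'h::banach \<Rightarrow> 'h"
  assumes E: "C0_semigroup E"
  obtains \<delta> B where "\<delta> > 0" "\<And>t x. 0 \<le> t \<Longrightarrow> t \<le> \<delta> \<Longrightarrow> norm (E t x) \<le> B * norm x"
proof -
  have bl: "bounded_linear (E t)" if "t \<ge> 0" for t
    using E that by (simp add: C0_semigroup_def)
  have lim: "((\<lambda>t. E t x) \<longlongrightarrow> x) (at_right 0)" for x
    using E by (simp add: C0_semigroup_def)
  have E0: "E 0 x = x" for x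
    using E by (simp add: C0_semigroup_def)
  define V where "V n = {x. \<forall>t\<in>{0..1 / Suc n}. norm (E t x) \<le> real n}" for n
  have closed_V: "closed (V n)" for n
  proof -
    have "V n = (\<Inter>t\<in>{0..1 / Suc n}. {x. norm (E t x) \<le> real n})"
      unfolding V_def by auto
    moreover have "closed {x. norm (E t x) \<le> real n}" if "t \<in> {0..1 / Suc n}" for t
      using that by (intro closed_Collect_le continuous_intros linear_continuous_on[OF bl]) auto
    ultimately show ?thesis by auto
  qed
  have cover: "\<exists>n. x \<in> V n" for x
  proof -
    have "\<forall>\<^sub>F t in at_right 0. dist (E t x) x < 1"
      using lim[of x] by (rule tendstoD) simp
    then obtain d where d: "d > 0" "\<And>t. 0 < t \<Longrightarrow> t < d \<Longrightarrow> dist (E t x) x < 1"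
      unfolding eventually_at_right_field by auto
    obtain n1 where n1: "1 / real (Suc n1) < d"
      using d(1) by (meson nat_approx_posE)
    obtain n2 where n2: "norm x + 1 \<le> real n2"
      using real_arch_simple by blast
    define n where "n = max n1 n2"
    have n: "1 / real (Suc n) < d" "norm x + 1 \<le> real n"
      using n1 n2 unfolding n_def
      by (auto intro: le_less_trans[OF _ n1] simp: frac_le max_def)
    have "norm (E t x) \<le> real n" if t: "0 \<le> t" "t \<le> 1 / Suc n" for t
    proof (cases "t = 0")
      case False
      then have "dist (E t x) x < 1"
        using t n(1) by (intro d(2)) auto
      then have "norm (E t x) \<le> norm x + 1"
        by norm
      then show ?thesis using n(2) by simp
    qed (use n(2) E0 in auto)
    then show ?thesis by (intro exI[of _ n]) (simp add: V_def)
  qed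
  \<comment> \<open>If no \<open>V n\<close> had interior points, the complements would be open and
    dense, and by Baire their intersection, which is empty, would be dense.\<close>
  have "\<exists>n. interior (V n) \<noteq> {}"
  proof (rule ccontr)
    assume "\<not> (\<exists>n. interior (V n) \<noteq> {})"
    then have "(euclidean :: 'h topology) closure_of \<Inter>(range (\<lambda>n. - V n)) = topspace euclidean"
      using closed_V
      by (intro Baire_category)
        (auto simp: closure_complement completely_metrizable_space_euclidean open_Compl)
    moreover have "\<Inter>(range (\<lambda>n. - V n)) = {}"
      using cover by auto
    ultimately show False by simp
  qed
  then obtain n x0 where "x0 \<in> interior (V n)" by auto
  then obtain r where r: "r > 0" "cball x0 r \<subseteq> V n"
    by (meson mem_interior_cball)
  show ?thesis
  proof
    show "1 / real (Suc n) > 0" by simp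
    fix t :: real and x :: 'h
    assume t: "0 \<le> t" "t \<le> 1 / real (Suc n)"
    interpret bounded_linear "E t" by (rule bl) fact
    show "norm (E t x) \<le> (2 * real n / r) * norm x"
    proof (cases "x = 0")
      case False
      \<comment> \<open>\<open>x\<close> is rescaled to norm \<open>r\<close>, so that
        \<open>x0\<close> and \<open>x0 + y\<close> both lie in \<open>V n\<close>; their difference
        bounds \<open>E t y\<close> by \<open>2 * real n\<close>.\<close>
      define y where "y = (r / norm x) *\<^sub>R x"
      have "norm y = r" using False r(1) by (simp add: y_def)
      then have "x0 \<in> V n" "x0 + y \<in> V n"
        using r by (auto simp: subset_iff dist_norm)
      then have "norm (E t (x0 + y)) \<le> n" "norm (E t x0) \<le> n"
        using t by (auto simp: V_def)
      then have "norm (E t y) \<le> 2 * real n"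
        unfolding add by norm
      then have "(r / norm x) * norm (E t x) \<le> 2 * real n"
        using r(1) by (simp add: y_def scaleR)
      then show ?thesis using r(1) False by (simp add: field_simps)
    qed (simp add: zero)
  qed
qed

text \<open>The semigroup law carries the bound from \<open>[0, \<delta>]\<close> to any multiple of
  this interval, at the price of one more factor for each step.\<close>

lemma C0_semigroup_locally_bounded:
  fixes E :: "real \<Rightarrow> 'h::banach \<Rightarrow> 'h"
  assumes E: "C0_semigroup E"
  obtains B where "B \<ge> 0" "\<And>t x. 0 \<le> t \<Longrightarrow> t \<le> T \<Longrightarrow> norm (E t x) \<le> B * norm x"
proof -
  obtain \<delta> B where \<delta>: "\<delta> > 0" and B: "\<And>t x. 0 \<le> t \<Longrightarrow> t \<le> \<delta> \<Longrightarrow> norm (E t x) \<le> B * norm x"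
    by (rule C0_semigroup_bounded_near_0[OF E]) blast
  \<comment> \<open>Powers of a number that is at least 1 increase, so the last power bounds all
    times up to \<open>T\<close>.\<close>
  define B' where "B' = max B 1"
  have B': "norm (E t x) \<le> B' * norm x" if "0 \<le> t" "t \<le> \<delta>" for t x
    using B[OF that, of x] by (rule order_trans) (auto simp: B'_def intro: mult_right_mono)
  have Eadd: "E (s + r) x = E s (E r x)" if "s \<ge> 0" "r \<ge> 0" for s r x
    using E that by (simp add: C0_semigroup_def)
  have *: "norm (E t x) \<le> B' ^ Suc k * norm x" if "0 \<le> t" "t \<le> real (Suc k) * \<delta>" for t x k
    using that
  proof (induction k arbitrary: t)
    case 0
    then show ?case using B' by simp
  next
    case (Suc k)
    show ?case
    proof (cases "t \<le> \<delta>")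
      case True
      then have "norm (E t x) \<le> B' * norm x" using B' Suc by simp
      also have "\<dots> \<le> B' ^ Suc (Suc k) * norm x"
        by (intro mult_right_mono self_le_power) (auto simp: B'_def)
      finally show ?thesis .
    next
      case False
      then have "E t x = E \<delta> (E (t - \<delta>) x)"
        using Eadd[of \<delta> "t - \<delta>" x] \<delta> by simp
      also have "norm \<dots> \<le> B' * norm (E (t - \<delta>) x)"
        using \<delta> by (intro B') auto
      also have "\<dots> \<le> B' * (B' ^ Suc k * norm x)"
        using Suc False by (intro mult_left_mono Suc.IH) (auto simp: algebra_simps B'_def)
      finally show ?thesis by (simp add: mult_ac)
    qed
  qed
  obtain k where "T / \<delta> \<le> real k" using real_arch_simple by blast
  then have "T \<le> real (Suc k) * \<delta>" using \<delta> by (simp add: field_simps)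
  then show ?thesis
    using * by (intro that[of "B' ^ Suc k"]) (auto simp: B'_def simp del: power_Suc)
qed

text \<open>The orbit is compared with the exponential over \<open>Suc N\<close> equal steps of
  length \<open>h\<close>. Each step adds an error of at most \<open>B * (h * r h)\<close>, where
  \<open>r h\<close> tends to 0, and \<open>real (Suc N) * h = t\<close>, so the total is at most
  \<open>B * t * r h\<close>. The only derivative involved is the right derivative at time 0, which
  is what \<open>generator\<close> records.\<close>

lemma C0_semigroup_eigenvector:
  fixes E :: "real \<Rightarrow> 'h::banach \<Rightarrow> 'h"
  assumes E: "C0_semigroup E" and gen: "(x, - (\<mu> *\<^sub>R x)) \<in> generator E"
    and \<mu>: "\<mu> \<ge> 0" and t: "t \<ge> 0"
  shows "E t x = exp (- \<mu> * t) *\<^sub>R x"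
proof (cases "t = 0")
  case True
  then show ?thesis using E by (simp add: C0_semigroup_def)
next
  case False
  then have t: "t > 0" using \<open>t \<ge> 0\<close> by simp
  have bl: "bounded_linear (E t)" if "t \<ge> 0" for t
    using E that by (simp add: C0_semigroup_def)
  have E0: "E 0 x = x" for x
    using E by (simp add: C0_semigroup_def)
  have Eadd: "E (s + r) x = E s (E r x)" if "s \<ge> 0" "r \<ge> 0" for s r x
    using E that by (simp add: C0_semigroup_def)
  obtain B where B: "B \<ge> 0" "\<And>s x. 0 \<le> s \<Longrightarrow> s \<le> t \<Longrightarrow> norm (E s x) \<le> B * norm x"
    by (rule C0_semigroup_locally_bounded[OF E]) blast
  define r where "r h = norm ((E h x - exp (- \<mu> * h) *\<^sub>R x) /\<^sub>R h)" for h
  have r0: "(r \<longlongrightarrow> 0) (at_right 0)"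
  proof -
    have 1: "((\<lambda>h. (E h x - x) /\<^sub>R h) \<longlongrightarrow> - (\<mu> *\<^sub>R x)) (at_right 0)"
      using gen by (simp add: generator_def)
    have "((\<lambda>h. ((exp (- \<mu> * h) - 1) / h) *\<^sub>R x) \<longlongrightarrow> (- \<mu>) *\<^sub>R x) (at_right 0)"
      by (intro tendsto_intros exp_difference_quotient)
    from tendsto_norm[OF tendsto_diff[OF 1 this]]
    have "((\<lambda>h. norm ((E h x - x) /\<^sub>R h - ((exp (- \<mu> * h) - 1) / h) *\<^sub>R x)) \<longlongrightarrow> 0) (at_right 0)"
      by simp
    moreover have "norm ((E h x - x) /\<^sub>R h - ((exp (- \<mu> * h) - 1) / h) *\<^sub>R x) = r h" for h
      unfolding r_def by (simp add: divide_inverse algebra_simps)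
    ultimately show ?thesis by simp
  qed
  have bound: "norm (E t x - exp (- \<mu> * t) *\<^sub>R x) \<le> B * t * r (t / real (Suc N))" for N
  proof -
    define h where "h = t / real (Suc N)"
    define c where "c = exp (- \<mu> * h)"
    have h: "h > 0" using t by (simp add: h_def)
    have c: "0 \<le> c" "c \<le> 1" using h \<mu> by (auto simp: c_def)
    have "norm (E (real k * h) x - c ^ k *\<^sub>R x) \<le> real k * B * (h * r h)" if "k \<le> Suc N" for k
      using that
    proof (induction k)
      case 0
      then show ?case using E0 by simp
    next
      case (Suc k)
      have kh: "0 \<le> real k * h" "real k * h \<le> t"
        using Suc.prems h mult_right_mono[of "real k" "real (Suc N)" h]
        by (simp, simp add: h_def)
      interpret bounded_linear "E (real k * h)" by (rule bl) fact
      have "E (real (Suc k) * h) x = E (real k * h) (E h x)"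
        using Eadd[OF kh(1), of h x] h by (simp add: algebra_simps)
      \<comment> \<open>Telescoping: the new error is transported by \<open>E (real k * h)\<close>,
        the accumulated one is multiplied by \<open>c \<le> 1\<close> and so not amplified.\<close>
      then have "E (real (Suc k) * h) x - c ^ Suc k *\<^sub>R x
          = E (real k * h) (E h x - c *\<^sub>R x) + c *\<^sub>R (E (real k * h) x - c ^ k *\<^sub>R x)"
        unfolding diff scaleR by (simp add: algebra_simps)
      also have "norm \<dots> \<le> norm (E (real k * h) (E h x - c *\<^sub>R x))
          + norm (c *\<^sub>R (E (real k * h) x - c ^ k *\<^sub>R x))"
        by (rule norm_triangle_ineq)
      also have "\<dots> \<le> B * norm (E h x - c *\<^sub>R x) + 1 * (real k * B * (h * r h))"
        using Suc c h unfolding norm_scaleR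
        by (intro add_mono B kh mult_mono) (auto simp: r_def B)
      also have "norm (E h x - c *\<^sub>R x) = h * r h"
        using h by (simp add: r_def c_def)
      finally show ?case by (simp add: algebra_simps)
    qed
    from this[of "Suc N"]
    have "norm (E (real (Suc N) * h) x - c ^ Suc N *\<^sub>R x) \<le> real (Suc N) * B * (h * r h)"
      by simp
    moreover have Nh: "real (Suc N) * h = t" by (simp add: h_def)
    moreover have "c ^ Suc N = exp (- \<mu> * t)"
      unfolding c_def exp_of_nat_mult[symmetric] Nh[symmetric] by (simp add: algebra_simps)
    ultimately have "norm (E t x - exp (- \<mu> * t) *\<^sub>R x) \<le> real (Suc N) * B * (h * r h)"
      by simp
    also have "\<dots> = B * (real (Suc N) * h) * r h" by (simp add: mult_ac)
    finally show ?thesis unfolding Nh by (simp add: h_def)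
  qed
  have "filterlim (\<lambda>N. t / real (Suc N)) (at_right 0) sequentially"
    unfolding filterlim_at
    using t lim_const_over_n[of t, THEN LIMSEQ_Suc] by (auto simp: eventually_sequentially)
  then have "(\<lambda>N. B * t * r (t / real (Suc N))) \<longlonglongrightarrow> B * t * 0"
    by (intro tendsto_mult_left filterlim_compose[OF r0])
  then have "norm (E t x - exp (- \<mu> * t) *\<^sub>R x) \<le> B * t * 0"
    by (rule LIMSEQ_le_const) (use bound in auto)
  then show ?thesis by simp
qed

text \<open>\<open>E t\<close> is continuous and acts on the expansion of \<open>x\<close> term by
  term, scaling each \<open>e k\<close> by its exponential; only the term \<open>k = n\<close>
  survives the pairing with \<open>e n\<close>.\<close>

lemma eigenbasis_semigroup_inner:
  fixes E :: "real \<Rightarrow> 'h::{real_inner, banach} \<Rightarrow> 'h"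
  assumes E: "generated_by_minus A E" and e: "eigenbasis A e \<mu>" and t: "t \<ge> 0"
  shows "E t x \<bullet> e n = exp (- \<mu> n * t) * (x \<bullet> e n)"
proof -
  have sg: "C0_semigroup E" and gen: "generator E = {(x, - y) | x y. (x, y) \<in> A}"
    using E by (auto simp: generated_by_minus_def)
  have onb: "orthonormal_basis e" and \<mu>: "\<And>n. 0 < \<mu> n" and eA: "\<And>n. (e n, \<mu> n *\<^sub>R e n) \<in> A"
    using e by (auto simp: eigenbasis_def)
  interpret bounded_linear "E t"
    using sg t by (simp add: C0_semigroup_def)
  have Ee: "E t (e k) = exp (- \<mu> k * t) *\<^sub>R e k" for k
    using eA[of k] \<mu>[of k] by (intro C0_semigroup_eigenvector sg t) (auto simp: gen)
  have "(\<lambda>k. E t ((x \<bullet> e k) *\<^sub>R e k) \<bullet> e n) sums (E t x \<bullet> e n)"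
    by (intro bounded_linear.sums[OF bounded_linear_inner_left] sums orthonormal_basis_sums onb)
  moreover have "E t ((x \<bullet> e k) *\<^sub>R e k) \<bullet> e n
      = (if k = n then exp (- \<mu> n * t) * (x \<bullet> e n) else 0)" for k
    by (simp add: scaleR Ee orthonormal_basis_inner[OF onb])
  ultimately show ?thesis
    using sums_unique2 sums_single[of n "\<lambda>_. exp (- \<mu> n * t) * (x \<bullet> e n)"] by (simp add: eq_commute)
qed

lemma eigenbasis_semigroup_contraction:
  fixes E :: "real \<Rightarrow> 'h::{real_inner, banach} \<Rightarrow> 'h"
  assumes E: "generated_by_minus A E" and e: "eigenbasis A e \<mu>" and t: "t \<ge> 0"
  shows "norm (E t x) \<le> norm x"
proof -
  have onb: "orthonormal_basis e" and \<mu>: "\<And>n. 0 < \<mu> n"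
    using e by (auto simp: eigenbasis_def)
  have "(\<Sum>n. ennreal ((E t x \<bullet> e n)\<^sup>2)) \<le> (\<Sum>n. ennreal ((x \<bullet> e n)\<^sup>2))"
    using \<mu> t
    by (intro suminf_le ennreal_leI)
      (auto simp: eigenbasis_semigroup_inner[OF assms] power_mult_distrib less_imp_le
        intro!: mult_left_le_one_le power_le_one)
  then show ?thesis
    by (simp add: parseval[OF onb])
qed

lemma eigenbasis_resolvent_inner:
  fixes E :: "real \<Rightarrow> 'h::{real_inner, banach} \<Rightarrow> 'h"
  assumes E: "generated_by_minus A E" and e: "eigenbasis A e \<mu>" and uv: "(u, v) \<in> id_plus A"
  shows "v \<bullet> e n = (1 + \<mu> n) * (u \<bullet> e n)"
proof -
  obtain y where y: "v = u + y" "(u, y) \<in> A"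
    using uv by (auto simp: id_plus_def)
  then have "(u, - y) \<in> generator E"
    using E by (auto simp: generated_by_minus_def)
  then have "((\<lambda>t. ((E t u - u) /\<^sub>R t) \<bullet> e n) \<longlongrightarrow> (- y) \<bullet> e n) (at_right 0)"
    unfolding generator_def by (intro tendsto_inner) auto
  moreover have "\<forall>\<^sub>F t in at_right 0. ((E t u - u) /\<^sub>R t) \<bullet> e n
      = ((exp (- \<mu> n * t) - 1) / t) * (u \<bullet> e n)"
    using eventually_at_right_less[of 0]
    by eventually_elim
      (simp add: eigenbasis_semigroup_inner[OF E e] inner_diff_left field_simps)
  ultimately have "((\<lambda>t. ((exp (- \<mu> n * t) - 1) / t) * (u \<bullet> e n))
      \<longlongrightarrow> (- y) \<bullet> e n) (at_right 0)"
    by (rule Lim_transform_eventually)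
  moreover have "((\<lambda>t. ((exp (- \<mu> n * t) - 1) / t) * (u \<bullet> e n))
      \<longlongrightarrow> (- \<mu> n) * (u \<bullet> e n)) (at_right 0)"
    by (intro tendsto_mult_right exp_difference_quotient)
  ultimately have "(- y) \<bullet> e n = (- \<mu> n) * (u \<bullet> e n)"
    by (intro tendsto_unique[of "at_right (0::real)"]) auto
  then show ?thesis
    by (simp add: y(1) inner_add_left algebra_simps)
qed

section \<open>Elementary integrals with respect to a Wiener process\<close>

lemma centered_gaussian_moments:
  assumes "var \<ge> 0"
  shows "has_bochner_integral (centered_gaussian var) (\<lambda>x. x) 0"
    and "has_bochner_integral (centered_gaussian var) (\<lambda>x. x\<^sup>2) var"
proof -
  have "has_bochner_integral (centered_gaussian var) (\<lambda>x. x) 0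
      \<and> has_bochner_integral (centered_gaussian var) (\<lambda>x. x\<^sup>2) var"
  proof (cases "var = 0")
    case True
    have *: "has_bochner_integral (return borel 0) g (0::real)" if "g 0 = 0" "g \<in> borel_measurable borel"
      for g :: "real \<Rightarrow> real"
    proof -
      have "AE x in return borel 0. g x = 0"
        using that by (subst AE_return) auto
      then show ?thesis
        using has_bochner_integral_cong_AE[of g "return borel 0" "\<lambda>_. 0" 0] that
        by (simp add: has_bochner_integral_zero)
    qed
    have "has_bochner_integral (return borel 0) (\<lambda>x::real. x) 0"
      by (rule *) simp_all
    moreover have "has_bochner_integral (return borel 0) (\<lambda>x::real. x\<^sup>2) 0"
      by (rule *) simp_all
    moreover have "centered_gaussian var = return borel 0"
      unfolding centered_gaussian_def using True by (rule if_P)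
    ultimately show ?thesis
      unfolding True by metis
  next
    case False
    then have "sqrt var > 0" using assms by simp
    from normal_moment_odd[OF this, of 0 0] normal_moment_even[OF this, of 0 1] assms False
    show ?thesis
      by (auto simp: centered_gaussian_def intro!: has_bochner_integral_density)
  qed
  then show "has_bochner_integral (centered_gaussian var) (\<lambda>x. x) 0"
    and "has_bochner_integral (centered_gaussian var) (\<lambda>x. x\<^sup>2) var" by auto
qed

lemma integrable_mult_of_squares:
  fixes X Y :: "'w \<Rightarrow> real"
  assumes [measurable]: "X \<in> borel_measurable M" "Y \<in> borel_measurable M"
    and X: "integrable M (\<lambda>\<omega>. (X \<omega>)\<^sup>2)" and Y: "integrable M (\<lambda>\<omega>. (Y \<omega>)\<^sup>2)"
  shows "integrable M (\<lambda>\<omega>. X \<omega> * Y \<omega>)"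
proof (rule Bochner_Integration.integrable_bound)
  show "integrable M (\<lambda>\<omega>. (X \<omega>)\<^sup>2 + (Y \<omega>)\<^sup>2)"
    using X Y by (rule Bochner_Integration.integrable_add)
  have "\<bar>x * y\<bar> \<le> x\<^sup>2 + y\<^sup>2" for x y :: real
    using sum_squares_bound[of x y] sum_squares_bound[of "- x" y] sum_power2_ge_zero[of x y]
    unfolding abs_le_iff by simp
  then show "AE \<omega> in M. norm (X \<omega> * Y \<omega>) \<le> norm ((X \<omega>)\<^sup>2 + (Y \<omega>)\<^sup>2)"
    by simp
qed simp

text \<open>This is \<open>0 \<le> Q (x - y) \<bullet> (x - y)\<close> expanded. It stands in for
  the triangle inequality of the seminorm given by the square root of \<open>Q\<close>, which is
  never constructed.\<close>

lemma positive_op_quadratic_add_le: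
  assumes "positive_op Q"
  shows "Q (x + y) \<bullet> (x + y) \<le> 2 * (Q x \<bullet> x) + 2 * (Q y \<bullet> y)"
proof -
  interpret bounded_linear Q using assms by (simp add: positive_op_def)
  have "0 \<le> Q (x - y) \<bullet> (x - y)" using assms unfolding positive_op_def by blast
  then show ?thesis by (simp add: add diff inner_add inner_diff algebra_simps)
qed

text \<open>Splitting off \<open>z\<close> and then separating \<open>x\<close> from
  \<open>y\<close> doubles the first two weights once more. The weights 4, 4, 2 recur in all
  three-term estimates below.\<close>

lemma positive_op_quadratic_add3_le:
  assumes "positive_op Q"
  shows "Q (x + y + z) \<bullet> (x + y + z) \<le> 4 * (Q x \<bullet> x) + 4 * (Q y \<bullet> y) + 2 * (Q z \<bullet> z)"
  using positive_op_quadratic_add_le[OF assms, of x y]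
    positive_op_quadratic_add_le[OF assms, of "x + y" z] by simp

lemma positive_op_quadratic_minus:
  assumes "positive_op Q"
  shows "Q (- x) \<bullet> (- x) = Q x \<bullet> x"
proof -
  interpret bounded_linear Q using assms by (simp add: positive_op_def)
  show ?thesis by (simp add: neg)
qed

text \<open>The intervals in the list may overlap and come in any order. The difference of two
  elementary integrands is then a concatenation of lists, and no common refinement of two partitions
  has to be formed.\<close>

definition elem_fun :: "(real \<times> real \<times> 'h::real_vector) list \<Rightarrow> real \<Rightarrow> 'h" where
  "elem_fun xs \<tau> = (\<Sum>(a, b, h)\<leftarrow>xs. indicator {a<..b} \<tau> *\<^sub>R h)"

definition elem_integral ::
    "(real \<Rightarrow> 'w \<Rightarrow> 'h::real_inner) \<Rightarrow> (real \<times> real \<times> 'h) list \<Rightarrow> 'w \<Rightarrow> real" where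
  "elem_integral W xs \<omega> = (\<Sum>(a, b, h)\<leftarrow>xs. (W b \<omega> - W a \<omega>) \<bullet> h)"

definition elem_valid :: "(real \<times> real \<times> 'h) list \<Rightarrow> bool" where
  "elem_valid xs \<longleftrightarrow> (\<forall>(a, b, h)\<in>set xs. 0 \<le> a \<and> a \<le> b)"

definition elem_diff where
  "elem_diff xs ys = xs @ map (\<lambda>(a, b, h). (a, b, - h)) ys"

lemma elem_fun_simps:
  "elem_fun [] \<tau> = 0"
  "elem_fun ((a, b, h) # xs) \<tau> = indicator {a<..b} \<tau> *\<^sub>R h + elem_fun xs \<tau>"
  by (auto simp: elem_fun_def)

lemma elem_integral_simps:
  "elem_integral W [] \<omega> = 0"
  "elem_integral W ((a, b, h) # xs) \<omega> = (W b \<omega> - W a \<omega>) \<bullet> h + elem_integral W xs \<omega>"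
  by (auto simp: elem_integral_def)

lemma elem_valid_simps:
  "elem_valid []"
  "elem_valid ((a, b, h) # xs) \<longleftrightarrow> 0 \<le> a \<and> a \<le> b \<and> elem_valid xs"
  by (auto simp: elem_valid_def)

lemmas elem_simps = elem_fun_simps elem_integral_simps elem_valid_simps

lemma elem_fun_diff: "elem_fun (elem_diff xs ys) \<tau> = elem_fun xs \<tau> - elem_fun ys \<tau>"
proof -
  have "elem_fun (map (\<lambda>(a, b, h). (a, b, - h)) ys) \<tau> = - elem_fun ys \<tau>"
    by (induction ys) (auto simp: elem_simps)
  then show ?thesis
    unfolding elem_diff_def elem_fun_def by simp
qed

lemma elem_integral_diff:
  "elem_integral W (elem_diff xs ys) \<omega> = elem_integral W xs \<omega> - elem_integral W ys \<omega>"
proof -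
  have "elem_integral W (map (\<lambda>(a, b, h). (a, b, - h)) ys) \<omega> = - elem_integral W ys \<omega>"
    by (induction ys) (auto simp: elem_simps)
  then show ?thesis
    unfolding elem_diff_def elem_integral_def by simp
qed

lemma elem_valid_diff: "elem_valid (elem_diff xs ys) \<longleftrightarrow> elem_valid xs \<and> elem_valid ys"
  unfolding elem_diff_def elem_valid_def by (auto simp: ball_Un)

lemma elem_fun_measurable [measurable]:
  fixes xs :: "(real \<times> real \<times> 'h::{real_normed_vector, second_countable_topology}) list"
  shows "elem_fun xs \<in> borel_measurable borel"
proof (induction xs)
  case (Cons x xs)
  then show ?case
    by (cases x) (simp add: elem_simps(2)[abs_def])
qed (simp add: elem_simps(1)[abs_def])

text \<open>The length of the intersection is expressed through minima of endpoints, also when the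
  intervals are disjoint, because the covariance of two increments of a Wiener process has the same
  form; the two sides of the isometry then agree literally.\<close>

lemma indicator_interval_product_integral:
  fixes a b c d r :: real
  assumes "a \<le> b" "c \<le> d"
  shows "has_bochner_integral lborel (\<lambda>\<tau>. indicator {c<..d} \<tau> * (indicator {a<..b} \<tau> * r))
    ((min b d - min a d - min b c + min a c) * r)"
proof -
  have *: "indicator {c<..d} \<tau> * (indicator {a<..b} \<tau> * r)
      = indicator {max a c<..min b d} \<tau> * r" for \<tau>
    by (auto simp: indicator_def)
  have "has_bochner_integral lborel (indicator {max a c<..min b d})
      (measure lborel {max a c<..min b d})"
    by (intro has_bochner_integral_real_indicator emeasure_bounded_finite)
      (auto intro: bounded_subset[OF bounded_closed_interval])
  moreover have "measure lborel {max a c<..min b d} = min b d - min a d - min b c + min a c"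
    using assms by (cases "max a c \<le> min b d") (auto simp: min_def max_def split: if_splits)
  ultimately show ?thesis
    unfolding * by (intro has_bochner_integral_mult_left) auto
qed

section \<open>Covariances of the increments and the Ito isometry for elementary integrands\<close>

locale wiener = prob_space M
  for M :: "'w measure" +
  fixes F :: "real \<Rightarrow> 'w measure"
    and Q :: "'h::{real_inner, banach, second_countable_topology} \<Rightarrow> 'h"
    and W :: "real \<Rightarrow> 'w \<Rightarrow> 'h"
  assumes filtration: "usual_filtration M F"
    and Q: "positive_op Q"
    and W: "wiener_process M F Q W"
begin

lemma W_adapted: "t \<ge> 0 \<Longrightarrow> W t \<in> borel_measurable (F t)"
  using W by (simp add: wiener_process_def)

lemma W_adapted_le: "0 \<le> s \<Longrightarrow> s \<le> t \<Longrightarrow> W s \<in> borel_measurable (F t)"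
  using filtration W_adapted unfolding usual_filtration_def
  by (meson measurable_from_subalg)

lemma F_subalgebra: "t \<ge> 0 \<Longrightarrow> subalgebra M (F t)"
  using filtration by (simp add: usual_filtration_def)

lemma W_measurable [measurable]: "t \<ge> 0 \<Longrightarrow> W t \<in> borel_measurable M"
  using F_subalgebra W_adapted by (meson measurable_from_subalg)

lemma Q_bounded_linear: "bounded_linear Q"
  using Q by (simp add: positive_op_def)

lemma Q_measurable [measurable]: "Q \<in> borel_measurable borel"
  by (intro borel_measurable_continuous_onI linear_continuous_on Q_bounded_linear)

lemma Q_nonneg: "0 \<le> Q x \<bullet> x"
  using Q unfolding positive_op_def by blast

lemma Q_sym: "Q x \<bullet> y = Q y \<bullet> x"
  using Q unfolding positive_op_def by (metis inner_commute)

lemma increment_moments: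
  assumes "0 \<le> s" "s \<le> t"
  shows "has_bochner_integral M (\<lambda>\<omega>. (W t \<omega> - W s \<omega>) \<bullet> h) 0"
    and "has_bochner_integral M (\<lambda>\<omega>. ((W t \<omega> - W s \<omega>) \<bullet> h)\<^sup>2) ((t - s) * (Q h \<bullet> h))"
proof -
  have [measurable]: "(\<lambda>\<omega>. (W t \<omega> - W s \<omega>) \<bullet> h) \<in> borel_measurable M"
    using assms by simp
  have d: "distr M borel (\<lambda>\<omega>. (W t \<omega> - W s \<omega>) \<bullet> h) = centered_gaussian ((t - s) * (Q h \<bullet> h))"
    using W assms by (simp add: wiener_process_def)
  have "0 \<le> (t - s) * (Q h \<bullet> h)"
    using assms Q_nonneg by simp
  note m = centered_gaussian_moments[OF this, folded d]
  show "has_bochner_integral M (\<lambda>\<omega>. (W t \<omega> - W s \<omega>) \<bullet> h) 0"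
    using m(1) by (simp add: has_bochner_integral_iff integrable_distr_eq integral_distr)
  show "has_bochner_integral M (\<lambda>\<omega>. ((W t \<omega> - W s \<omega>) \<bullet> h)\<^sup>2) ((t - s) * (Q h \<bullet> h))"
    using m(2) by (simp add: has_bochner_integral_iff integrable_distr_eq integral_distr)
qed

lemma increment_integrable_mult:
  assumes "0 \<le> s" "s \<le> t" "0 \<le> s'" "s' \<le> t'"
  shows "integrable M (\<lambda>\<omega>. ((W t \<omega> - W s \<omega>) \<bullet> g) * ((W t' \<omega> - W s' \<omega>) \<bullet> h))"
  using assms increment_moments(2)[of s t g] increment_moments(2)[of s' t' h]
  by (intro integrable_mult_of_squares) (auto simp: has_bochner_integral_iff)

text \<open>The law is prescribed only for one functional of the increment at a time, so the mixed
  moment comes from the variances in the directions \<open>g\<close>, \<open>h\<close> and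
  \<open>g + h\<close> by polarization.\<close>

lemma increment_covariance:
  assumes "0 \<le> s" "s \<le> t"
  shows "has_bochner_integral M (\<lambda>\<omega>. ((W t \<omega> - W s \<omega>) \<bullet> g) * ((W t \<omega> - W s \<omega>) \<bullet> h))
    ((t - s) * (Q g \<bullet> h))"
proof -
  interpret Q: bounded_linear Q by (rule Q_bounded_linear)
  have sym: "Q h \<bullet> g = Q g \<bullet> h"
    by (rule Q_sym)
  have "has_bochner_integral M
      (\<lambda>\<omega>. (((W t \<omega> - W s \<omega>) \<bullet> (g + h))\<^sup>2 - ((W t \<omega> - W s \<omega>) \<bullet> g)\<^sup>2 - ((W t \<omega> - W s \<omega>) \<bullet> h)\<^sup>2) / 2)
      (((t - s) * (Q (g + h) \<bullet> (g + h)) - (t - s) * (Q g \<bullet> g) - (t - s) * (Q h \<bullet> h)) / 2)"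
    by (intro has_bochner_integral_divide_zero has_bochner_integral_diff increment_moments assms)
  moreover have "(((W t \<omega> - W s \<omega>) \<bullet> (g + h))\<^sup>2 - ((W t \<omega> - W s \<omega>) \<bullet> g)\<^sup>2 - ((W t \<omega> - W s \<omega>) \<bullet> h)\<^sup>2) / 2
      = ((W t \<omega> - W s \<omega>) \<bullet> g) * ((W t \<omega> - W s \<omega>) \<bullet> h)" for \<omega>
    unfolding inner_add_right power2_sum by simp
  moreover have "((t - s) * (Q (g + h) \<bullet> (g + h)) - (t - s) * (Q g \<bullet> g) - (t - s) * (Q h \<bullet> h)) / 2
      = (t - s) * (Q g \<bullet> h)"
    by (simp add: Q.add inner_add_left inner_add_right sym field_simps)
  ultimately show ?thesis by simp
qed

text \<open>\<open>X\<close> and the functional of the increment generate smaller sigma-algebras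
  than the two independent ones, so the expectation factorizes, and the increment has mean
  zero.\<close>

lemma past_increment_uncorrelated:
  assumes "0 \<le> s" "s \<le> t" and X: "X \<in> borel_measurable (F s)" "integrable M X"
  shows "expectation (\<lambda>\<omega>. X \<omega> * ((W t \<omega> - W s \<omega>) \<bullet> h)) = 0"
proof -
  let ?D = "\<lambda>\<omega>. W t \<omega> - W s \<omega>"
  have [measurable]: "?D \<in> borel_measurable M" using assms by simp
  have XM: "X \<in> borel_measurable M"
    using X(1) F_subalgebra[OF assms(1)] by (meson measurable_from_subalg)
  have sp: "space (F s) = space M"
    using F_subalgebra[OF assms(1)] by (simp add: subalgebra_def)
  have indep: "indep_set (sets (F s)) (sets (vimage_algebra (space M) ?D borel))"
    using W assms by (simp add: wiener_process_def)
  have "indep_set (sigma_sets (space M) {X -` A \<inter> space M |A. A \<in> sets borel})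
     (sigma_sets (space M) {(\<lambda>\<omega>. ?D \<omega> \<bullet> h) -` A \<inter> space M |A. A \<in> sets borel})"
  proof -
    have 1: "sigma_sets (space M) {X -` A \<inter> space M |A. A \<in> sets borel} \<subseteq> sets (F s)"
      unfolding sp[symmetric]
      by (intro sets.sigma_sets_subset) (use measurable_sets[OF X(1)] in auto)
    have D: "(\<lambda>\<omega>. ?D \<omega> \<bullet> h) \<in> borel_measurable (vimage_algebra (space M) ?D borel)"
      by (rule measurable_compose[where g="\<lambda>x. x \<bullet> h" and N=borel])
        (auto intro: measurable_vimage_algebra1)
    have 2: "sigma_sets (space M) {(\<lambda>\<omega>. ?D \<omega> \<bullet> h) -` A \<inter> space M |A. A \<in> sets borel}
        \<subseteq> sets (vimage_algebra (space M) ?D borel)"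
      using sets.sigma_sets_subset[of "{(\<lambda>\<omega>. ?D \<omega> \<bullet> h) -` A \<inter> space M |A. A \<in> sets borel}"
          "vimage_algebra (space M) ?D borel"] measurable_sets[OF D] by auto
    show ?thesis
      using indep 1 2 unfolding indep_sets2_eq by blast
  qed
  then have iv: "indep_var borel X borel (\<lambda>\<omega>. ?D \<omega> \<bullet> h)"
    unfolding indep_var_eq using XM by simp
  have D0: "has_bochner_integral M (\<lambda>\<omega>. ?D \<omega> \<bullet> h) 0"
    by (rule increment_moments) fact+
  then show ?thesis
    using indep_var_lebesgue_integral[OF iv X(2)] by (simp add: has_bochner_integral_iff)
qed

text \<open>The later increment splits at \<open>s\<close> into a repeated part and one uncorrelated
  with the past. \<open>W 0\<close> vanishes only almost surely; subtracting it keeps the identities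
  pointwise.\<close>

lemma W0_covariance_le:
  assumes "0 \<le> s" "s \<le> t"
  shows "expectation (\<lambda>\<omega>. ((W s \<omega> - W 0 \<omega>) \<bullet> g) * ((W t \<omega> - W 0 \<omega>) \<bullet> h)) = s * (Q g \<bullet> h)"
proof -
  have "expectation (\<lambda>\<omega>. ((W s \<omega> - W 0 \<omega>) \<bullet> g) * ((W t \<omega> - W 0 \<omega>) \<bullet> h))
      = expectation (\<lambda>\<omega>. ((W s \<omega> - W 0 \<omega>) \<bullet> g) * ((W s \<omega> - W 0 \<omega>) \<bullet> h)
          + ((W s \<omega> - W 0 \<omega>) \<bullet> g) * ((W t \<omega> - W s \<omega>) \<bullet> h))"
    by (intro Bochner_Integration.integral_cong refl) (simp add: inner_diff_left algebra_simps)
  also have "\<dots> = expectation (\<lambda>\<omega>. ((W s \<omega> - W 0 \<omega>) \<bullet> g) * ((W s \<omega> - W 0 \<omega>) \<bullet> h))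
      + expectation (\<lambda>\<omega>. ((W s \<omega> - W 0 \<omega>) \<bullet> g) * ((W t \<omega> - W s \<omega>) \<bullet> h))"
    by (intro Bochner_Integration.integral_add increment_integrable_mult) (use assms in auto)
  also have "expectation (\<lambda>\<omega>. ((W s \<omega> - W 0 \<omega>) \<bullet> g) * ((W s \<omega> - W 0 \<omega>) \<bullet> h)) = s * (Q g \<bullet> h)"
    using increment_covariance[of 0 s g h] assms by (simp add: has_bochner_integral_iff)
  also have "expectation (\<lambda>\<omega>. ((W s \<omega> - W 0 \<omega>) \<bullet> g) * ((W t \<omega> - W s \<omega>) \<bullet> h)) = 0"
  proof (rule past_increment_uncorrelated[OF assms])
    have [measurable]: "W s \<in> borel_measurable (F s)" "W 0 \<in> borel_measurable (F s)"
      using assms by (auto intro: W_adapted_le)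
    show "(\<lambda>\<omega>. (W s \<omega> - W 0 \<omega>) \<bullet> g) \<in> borel_measurable (F s)" by simp
    show "integrable M (\<lambda>\<omega>. (W s \<omega> - W 0 \<omega>) \<bullet> g)"
      using increment_moments(1)[of 0 s g] assms by (simp add: has_bochner_integral_iff)
  qed
  finally show ?thesis by simp
qed

lemma W0_covariance:
  assumes "0 \<le> s" "0 \<le> t"
  shows "has_bochner_integral M (\<lambda>\<omega>. ((W s \<omega> - W 0 \<omega>) \<bullet> g) * ((W t \<omega> - W 0 \<omega>) \<bullet> h))
    (min s t * (Q g \<bullet> h))"
proof -
  have sym: "Q h \<bullet> g = Q g \<bullet> h"
    by (rule Q_sym)
  have "expectation (\<lambda>\<omega>. ((W s \<omega> - W 0 \<omega>) \<bullet> g) * ((W t \<omega> - W 0 \<omega>) \<bullet> h)) = min s t * (Q g \<bullet> h)"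
  proof (cases "s \<le> t")
    case True
    then show ?thesis using W0_covariance_le[of s t g h] assms by simp
  next
    case False
    then show ?thesis
      using W0_covariance_le[of t s h g] assms unfolding sym by (simp add: mult.commute)
  qed
  then show ?thesis
    using increment_integrable_mult[of 0 s 0 t g h] assms by (simp add: has_bochner_integral_iff)
qed

text \<open>Both increments are written as differences of increments that start at 0, which reduces
  every relative position of the two intervals to the kernel \<open>min s t\<close>.\<close>

lemma increments_covariance:
  assumes "0 \<le> a" "a \<le> b" "0 \<le> c" "c \<le> d"
  shows "has_bochner_integral M (\<lambda>\<omega>. ((W b \<omega> - W a \<omega>) \<bullet> g) * ((W d \<omega> - W c \<omega>) \<bullet> h))
    ((min b d - min a d - min b c + min a c) * (Q g \<bullet> h))"
proof -
  let ?B = "\<lambda>t h \<omega>. (W t \<omega> - W 0 \<omega>) \<bullet> h"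
  have "has_bochner_integral M
     (\<lambda>\<omega>. ?B b g \<omega> * ?B d h \<omega> - ?B a g \<omega> * ?B d h \<omega> - ?B b g \<omega> * ?B c h \<omega> + ?B a g \<omega> * ?B c h \<omega>)
     (min b d * (Q g \<bullet> h) - min a d * (Q g \<bullet> h) - min b c * (Q g \<bullet> h) + min a c * (Q g \<bullet> h))"
    by (intro has_bochner_integral_add has_bochner_integral_diff W0_covariance)
      (use assms in linarith)+
  moreover have "?B b g \<omega> * ?B d h \<omega> - ?B a g \<omega> * ?B d h \<omega> - ?B b g \<omega> * ?B c h \<omega> + ?B a g \<omega> * ?B c h \<omega>
      = ((W b \<omega> - W a \<omega>) \<bullet> g) * ((W d \<omega> - W c \<omega>) \<bullet> h)" for \<omega>
    unfolding inner_diff_left by (simp only: algebra_simps)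
  moreover have "min b d * (Q g \<bullet> h) - min a d * (Q g \<bullet> h) - min b c * (Q g \<bullet> h) + min a c * (Q g \<bullet> h)
      = (min b d - min a d - min b c + min a c) * (Q g \<bullet> h)"
    unfolding left_diff_distrib distrib_right ..
  ultimately show ?thesis by (simp only:)
qed

text \<open>Unlike the square of one integral, the bilinear version can be proved by induction on
  each list, down to a pair of intervals. The existential value \<open>c\<close> lets integrability
  and equality of the two sides travel together.\<close>

lemma elem_isometry_polar:
  assumes "elem_valid xs" "elem_valid ys"
  shows "\<exists>c. has_bochner_integral M (\<lambda>\<omega>. elem_integral W xs \<omega> * elem_integral W ys \<omega>) c
    \<and> has_bochner_integral lborel (\<lambda>\<tau>. Q (elem_fun xs \<tau>) \<bullet> elem_fun ys \<tau>) c"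
  using assms(1)
proof (induction xs)
  case Nil
  then show ?case
    using bounded_linear.linear[OF Q_bounded_linear, THEN linear_0]
    by (intro exI[of _ 0] conjI) (simp_all add: elem_simps has_bochner_integral_zero)
next
  case (Cons x xs)
  obtain a b g where x: "x = (a, b, g)" by (cases x)
  interpret Q: bounded_linear Q by (rule Q_bounded_linear)
  have ab: "0 \<le> a" "a \<le> b" and xs: "elem_valid xs" using Cons.prems by (auto simp: x elem_simps)
  have "\<exists>c. has_bochner_integral M (\<lambda>\<omega>. ((W b \<omega> - W a \<omega>) \<bullet> g) * elem_integral W ys \<omega>) c
    \<and> has_bochner_integral lborel (\<lambda>\<tau>. Q (indicator {a<..b} \<tau> *\<^sub>R g) \<bullet> elem_fun ys \<tau>) c"
    using assms(2)
  proof (induction ys)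
    case (Cons y ys)
    obtain c d h where y: "y = (c, d, h)" by (cases y)
    have cd: "0 \<le> c" "c \<le> d" and ys: "elem_valid ys" using Cons.prems by (auto simp: y elem_simps)
    obtain r where r: "has_bochner_integral M (\<lambda>\<omega>. ((W b \<omega> - W a \<omega>) \<bullet> g) * elem_integral W ys \<omega>) r"
      "has_bochner_integral lborel (\<lambda>\<tau>. Q (indicator {a<..b} \<tau> *\<^sub>R g) \<bullet> elem_fun ys \<tau>) r"
      using Cons.IH[OF ys] by blast
    from has_bochner_integral_add[OF increments_covariance[OF ab cd, of g h] r(1)]
      has_bochner_integral_add[OF indicator_interval_product_integral[OF ab(2) cd(2), of "Q g \<bullet> h"] r(2)]
    show ?case
      unfolding y elem_simps by (auto simp: distrib_left Q.scaleR inner_add_right)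
  next
    case Nil
    show ?case
      by (intro exI[of _ 0] conjI) (simp_all add: elem_simps has_bochner_integral_zero)
  qed
  then obtain r where r: "has_bochner_integral M (\<lambda>\<omega>. ((W b \<omega> - W a \<omega>) \<bullet> g) * elem_integral W ys \<omega>) r"
      "has_bochner_integral lborel (\<lambda>\<tau>. Q (indicator {a<..b} \<tau> *\<^sub>R g) \<bullet> elem_fun ys \<tau>) r"
    by blast
  obtain c where c: "has_bochner_integral M (\<lambda>\<omega>. elem_integral W xs \<omega> * elem_integral W ys \<omega>) c"
    "has_bochner_integral lborel (\<lambda>\<tau>. Q (elem_fun xs \<tau>) \<bullet> elem_fun ys \<tau>) c"
    using Cons.IH[OF xs] by blast
  from has_bochner_integral_add[OF r(1) c(1)] has_bochner_integral_add[OF r(2) c(2)]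
  show ?case
    unfolding x elem_simps by (auto simp: distrib_right Q.add inner_add_left)
qed

lemma elem_isometry:
  assumes "elem_valid xs"
  shows "(\<integral>\<^sup>+\<omega>. ennreal ((elem_integral W xs \<omega>)\<^sup>2) \<partial>M)
    = (\<integral>\<^sup>+\<tau>. ennreal (Q (elem_fun xs \<tau>) \<bullet> elem_fun xs \<tau>) \<partial>lborel)"
proof -
  obtain c where c: "has_bochner_integral M (\<lambda>\<omega>. elem_integral W xs \<omega> * elem_integral W xs \<omega>) c"
    "has_bochner_integral lborel (\<lambda>\<tau>. Q (elem_fun xs \<tau>) \<bullet> elem_fun xs \<tau>) c"
    using elem_isometry_polar[OF assms assms] by blast
  show ?thesis
    using c by (simp add: nn_integral_eq_integral has_bochner_integral_iff Q_nonneg power2_eq_square)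
qed

lemma elem_integral_measurable [measurable]:
  "elem_valid xs \<Longrightarrow> elem_integral W xs \<in> borel_measurable M"
proof (induction xs)
  case (Cons x xs)
  then show ?case
    by (cases x) (auto simp: elem_simps elem_simps(4)[abs_def])
qed (simp add: elem_simps(3)[abs_def])

end

section \<open>Traces and coordinates of Wiener integrals\<close>

lemma is_step_mono:
  assumes "is_step t n s B" "i \<le> j" "j \<le> n"
  shows "s i \<le> s j"
  using assms(2,3)
proof (induction j)
  case (Suc j)
  then show ?case
    using assms(1) unfolding is_step_def
    by (metis Suc_le_eq le_SucE less_imp_le_nat order_trans order_refl)
qed simp

lemma power2_add3_le: "(x + y + z)\<^sup>2 \<le> 4 * x\<^sup>2 + 4 * y\<^sup>2 + 2 * (z\<^sup>2 :: real)"
proof -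
  have "(x + y)\<^sup>2 \<le> 2 * x\<^sup>2 + 2 * y\<^sup>2" for x y :: real
    using sum_squares_bound[of x y] by (simp add: power2_sum)
  from this[of x y] this[of "x + y" z] show ?thesis by simp
qed

lemma ennreal_le_combination3:
  assumes "0 \<le> a" "0 \<le> b" "0 \<le> c" "x \<le> 4 * a + 4 * b + 2 * c"
  shows "ennreal x \<le> 4 * ennreal a + 4 * ennreal b + 2 * ennreal c"
proof -
  have "ennreal x \<le> ennreal (4 * a + 4 * b + 2 * c)"
    by (intro ennreal_leI assms)
  also have "\<dots> = 4 * ennreal a + 4 * ennreal b + 2 * ennreal c"
    using assms by (simp add: ennreal_mult)
  finally show ?thesis .
qed

context wiener
begin

lemma W1_quadratic: "(\<integral>\<^sup>+\<omega>. ennreal (((W 1 \<omega> - W 0 \<omega>) \<bullet> h)\<^sup>2) \<partial>M) = ennreal (Q h \<bullet> h)"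
  using increment_moments(2)[of 0 1 h]
  by (simp add: nn_integral_eq_integral has_bochner_integral_iff)

text \<open>The right-hand side does not mention the basis: the Wiener process itself yields the basis
  independence of the traces of \<open>Q\<close> and \<open>S Q S\<^sup>*\<close>, without a square root of \<open>Q\<close>.\<close>

lemma suminf_W1_quadratic:
  assumes b: "orthonormal_basis b"
    and S: "bounded_linear S" and adj: "\<And>k x. S x \<bullet> b k = x \<bullet> g k"
  shows "(\<Sum>k. ennreal (Q (g k) \<bullet> g k)) = (\<integral>\<^sup>+\<omega>. ennreal ((norm (S (W 1 \<omega> - W 0 \<omega>)))\<^sup>2) \<partial>M)"
proof -
  have "(\<Sum>k. ennreal (Q (g k) \<bullet> g k))
      = (\<Sum>k. \<integral>\<^sup>+\<omega>. ennreal (((W 1 \<omega> - W 0 \<omega>) \<bullet> g k)\<^sup>2) \<partial>M)"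
    by (simp only: W1_quadratic)
  also have "\<dots> = (\<integral>\<^sup>+\<omega>. (\<Sum>k. ennreal ((S (W 1 \<omega> - W 0 \<omega>) \<bullet> b k)\<^sup>2)) \<partial>M)"
    unfolding adj by (intro nn_integral_suminf[symmetric]) simp
  also have "\<dots> = (\<integral>\<^sup>+\<omega>. ennreal ((norm (S (W 1 \<omega> - W 0 \<omega>)))\<^sup>2) \<partial>M)"
    by (simp only: parseval[OF b])
  finally show ?thesis .
qed

text \<open>\<open>pos_trace\<close> refers to a basis picked by choice. With the identity for
  \<open>S\<close>, the sums over that basis and over \<open>e\<close> are both the second moment of
  \<open>W 1 - W 0\<close>.\<close>

lemma pos_trace_eq_suminf:
  assumes "orthonormal_basis (e :: nat \<Rightarrow> 'h)"
  shows "pos_trace Q = (\<Sum>n. ennreal (Q (e n) \<bullet> e n))"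
proof -
  define b where "b = (SOME b :: nat \<Rightarrow> 'h. orthonormal_basis b)"
  have b: "orthonormal_basis b"
    unfolding b_def using assms by (rule someI[of orthonormal_basis])
  have "pos_trace Q = (\<Sum>n. ennreal (Q (b n) \<bullet> b n))"
    by (simp add: pos_trace_def Let_def b_def)
  also have "\<dots> = (\<Sum>n. ennreal (Q (e n) \<bullet> e n))"
    using suminf_W1_quadratic[OF b bounded_linear_ident, of b]
      suminf_W1_quadratic[OF assms bounded_linear_ident, of e] by simp
  finally show ?thesis .
qed

text \<open>The trace is the second moment of \<open>S (W 1 - W 0)\<close>, and one coordinate of a
  vector is dominated by its norm. The vector \<open>y\<close> is the adjoint of \<open>S\<close>
  applied to \<open>e n\<close>; it enters through its defining identity because the application
  knows it explicitly.\<close>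

lemma quadratic_le_pos_trace:
  assumes e: "orthonormal_basis e" and S: "bounded_linear (S :: 'h \<Rightarrow> 'h)"
    and adj: "\<And>x. S x \<bullet> e n = x \<bullet> y"
  shows "ennreal (Q y \<bullet> y) \<le> pos_trace (S \<circ> Q \<circ> adjoint S)"
proof -
  define b where "b = (SOME b :: nat \<Rightarrow> 'h. orthonormal_basis b)"
  have b: "orthonormal_basis b"
    unfolding b_def using e by (rule someI[of orthonormal_basis])
  have Sb: "S x \<bullet> b k = x \<bullet> adjoint S (b k)" for x k
    by (rule inner_adjoint[OF S b])
  interpret S: bounded_linear S by (rule S)
  have [measurable]: "S \<in> borel_measurable borel"
    by (intro borel_measurable_continuous_onI linear_continuous_on S)
  have "ennreal (Q y \<bullet> y) = (\<integral>\<^sup>+\<omega>. ennreal ((S (W 1 \<omega> - W 0 \<omega>) \<bullet> e n)\<^sup>2) \<partial>M)"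
    unfolding adj by (rule W1_quadratic[symmetric])
  also have "\<dots> \<le> (\<integral>\<^sup>+\<omega>. ennreal ((norm (S (W 1 \<omega> - W 0 \<omega>)))\<^sup>2) \<partial>M)"
    by (intro nn_integral_mono ennreal_leI inner_square_le_norm_square[OF e])
  also have "\<dots> = (\<Sum>k. ennreal (Q (adjoint S (b k)) \<bullet> adjoint S (b k)))"
    by (rule suminf_W1_quadratic[OF b S Sb, symmetric])
  also have "\<dots> = pos_trace (S \<circ> Q \<circ> adjoint S)"
    by (simp add: pos_trace_def Let_def b_def[symmetric] Sb)
  finally show ?thesis .
qed

text \<open>\<open>X\<close> is the integral of \<open>\<langle>g, dW\<rangle>\<close>, approximated by the elementary integrands \<open>xs\<close>.\<close>

definition scalar_approx ::
    "(nat \<Rightarrow> (real \<times> real \<times> 'h) list) \<Rightarrow> (real \<Rightarrow> 'h) \<Rightarrow> ('w \<Rightarrow> real) \<Rightarrow> bool" where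
  "scalar_approx xs g X \<longleftrightarrow> (\<forall>k. elem_valid (xs k)) \<and>
     g \<in> borel_measurable borel \<and> X \<in> borel_measurable M \<and>
     (\<lambda>k. \<integral>\<^sup>+\<tau>. ennreal (Q (elem_fun (xs k) \<tau> - g \<tau>) \<bullet> (elem_fun (xs k) \<tau> - g \<tau>)) \<partial>lborel) \<longlonglongrightarrow> 0 \<and>
     (\<lambda>k. \<integral>\<^sup>+\<omega>. ennreal ((elem_integral W (xs k) \<omega> - X \<omega>)\<^sup>2) \<partial>M) \<longlonglongrightarrow> 0"

text \<open>Comparison with the zero integrand turns a bound on differences into a bound on second
  moments.\<close>

lemma scalar_approx_zero: "scalar_approx (\<lambda>_. []) (\<lambda>_. 0) (\<lambda>_. 0)"
  by (simp add: scalar_approx_def elem_simps)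

text \<open>Both \<open>X1 - X2\<close> and the difference of the elementary integrands are split
  into two approximation errors and a main term, with the isometry between the two splittings. In
  the limit all errors vanish and the weight 2 of the main term, taken twice, leaves 4.\<close>

lemma scalar_approx_diff_bound:
  assumes xs: "scalar_approx xs g1 X1" and ys: "scalar_approx ys g2 X2"
  shows "(\<integral>\<^sup>+\<omega>. ennreal ((X1 \<omega> - X2 \<omega>)\<^sup>2) \<partial>M)
    \<le> 4 * (\<integral>\<^sup>+\<tau>. ennreal (Q (g1 \<tau> - g2 \<tau>) \<bullet> (g1 \<tau> - g2 \<tau>)) \<partial>lborel)"
proof -
  let ?q = "\<lambda>h. ennreal (Q h \<bullet> h)"
  have [measurable]: "g1 \<in> borel_measurable borel" "g2 \<in> borel_measurable borel"
    "X1 \<in> borel_measurable M" "X2 \<in> borel_measurable M"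
    and v: "elem_valid (xs k)" "elem_valid (ys k)" for k
    using xs ys by (auto simp: scalar_approx_def)
  define a where "a k = (\<integral>\<^sup>+\<omega>. ennreal ((elem_integral W (xs k) \<omega> - X1 \<omega>)\<^sup>2) \<partial>M)" for k
  define b where "b k = (\<integral>\<^sup>+\<omega>. ennreal ((elem_integral W (ys k) \<omega> - X2 \<omega>)\<^sup>2) \<partial>M)" for k
  define c where "c k = (\<integral>\<^sup>+\<tau>. ?q (elem_fun (xs k) \<tau> - g1 \<tau>) \<partial>lborel)" for k
  define d where "d k = (\<integral>\<^sup>+\<tau>. ?q (elem_fun (ys k) \<tau> - g2 \<tau>) \<partial>lborel)" for k
  define G where "G = (\<integral>\<^sup>+\<tau>. ?q (g1 \<tau> - g2 \<tau>) \<partial>lborel)"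
  have lim: "a \<longlonglongrightarrow> 0" "b \<longlonglongrightarrow> 0" "c \<longlonglongrightarrow> 0" "d \<longlonglongrightarrow> 0"
    using xs ys unfolding scalar_approx_def a_def b_def c_def d_def by auto
  have bound: "(\<integral>\<^sup>+\<omega>. ennreal ((X1 \<omega> - X2 \<omega>)\<^sup>2) \<partial>M)
      \<le> 4 * a k + 4 * b k + 2 * (4 * c k + 4 * d k + 2 * G)" for k
  proof -
    let ?I = "elem_integral W (elem_diff (xs k) (ys k))"
    let ?f = "elem_fun (elem_diff (xs k) (ys k))"
    note [measurable] = elem_integral_measurable[OF v(1)[of k]]
      elem_integral_measurable[OF v(2)[of k]]
    have [measurable]: "?I \<in> borel_measurable M"
      by (intro elem_integral_measurable) (simp add: elem_fun_diff elem_integral_diff elem_valid_diff v)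
    have "(\<integral>\<^sup>+\<omega>. ennreal ((X1 \<omega> - X2 \<omega>)\<^sup>2) \<partial>M)
        \<le> (\<integral>\<^sup>+\<omega>. 4 * ennreal ((elem_integral W (xs k) \<omega> - X1 \<omega>)\<^sup>2)
            + 4 * ennreal ((elem_integral W (ys k) \<omega> - X2 \<omega>)\<^sup>2) + 2 * ennreal ((?I \<omega>)\<^sup>2) \<partial>M)"
    proof (rule nn_integral_mono)
      fix \<omega>
      have "(X1 \<omega> - X2 \<omega>)\<^sup>2 \<le> 4 * (elem_integral W (xs k) \<omega> - X1 \<omega>)\<^sup>2
            + 4 * (elem_integral W (ys k) \<omega> - X2 \<omega>)\<^sup>2 + 2 * (?I \<omega>)\<^sup>2"
        using power2_add3_le[of "- (elem_integral W (xs k) \<omega> - X1 \<omega>)"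
            "elem_integral W (ys k) \<omega> - X2 \<omega>" "?I \<omega>"]
        unfolding power2_minus by (simp add: elem_fun_diff elem_integral_diff elem_valid_diff)
      then show "ennreal ((X1 \<omega> - X2 \<omega>)\<^sup>2) \<le> 4 * ennreal ((elem_integral W (xs k) \<omega> - X1 \<omega>)\<^sup>2)
            + 4 * ennreal ((elem_integral W (ys k) \<omega> - X2 \<omega>)\<^sup>2) + 2 * ennreal ((?I \<omega>)\<^sup>2)"
        by (intro ennreal_le_combination3) auto
    qed
    also have "\<dots> = 4 * a k + 4 * b k + 2 * (\<integral>\<^sup>+\<omega>. ennreal ((?I \<omega>)\<^sup>2) \<partial>M)"
      by (simp add: nn_integral_add nn_integral_cmult a_def b_def)
    also have "(\<integral>\<^sup>+\<omega>. ennreal ((?I \<omega>)\<^sup>2) \<partial>M) = (\<integral>\<^sup>+\<tau>. ?q (?f \<tau>) \<partial>lborel)"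
      by (rule elem_isometry) (simp add: elem_fun_diff elem_integral_diff elem_valid_diff v)
    also have "\<dots> \<le> (\<integral>\<^sup>+\<tau>. 4 * ?q (elem_fun (xs k) \<tau> - g1 \<tau>)
        + 4 * ?q (elem_fun (ys k) \<tau> - g2 \<tau>) + 2 * ?q (g1 \<tau> - g2 \<tau>) \<partial>lborel)"
    proof (rule nn_integral_mono)
      fix \<tau>
      have "Q (?f \<tau>) \<bullet> ?f \<tau> \<le> 4 * (Q (elem_fun (xs k) \<tau> - g1 \<tau>) \<bullet> (elem_fun (xs k) \<tau> - g1 \<tau>))
          + 4 * (Q (elem_fun (ys k) \<tau> - g2 \<tau>) \<bullet> (elem_fun (ys k) \<tau> - g2 \<tau>))
          + 2 * (Q (g1 \<tau> - g2 \<tau>) \<bullet> (g1 \<tau> - g2 \<tau>))"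
        using positive_op_quadratic_add3_le[OF Q, of "elem_fun (xs k) \<tau> - g1 \<tau>"
            "- (elem_fun (ys k) \<tau> - g2 \<tau>)" "g1 \<tau> - g2 \<tau>"]
        unfolding positive_op_quadratic_minus[OF Q] by (simp add: elem_fun_diff elem_integral_diff elem_valid_diff)
      then show "?q (?f \<tau>) \<le> 4 * ?q (elem_fun (xs k) \<tau> - g1 \<tau>)
          + 4 * ?q (elem_fun (ys k) \<tau> - g2 \<tau>) + 2 * ?q (g1 \<tau> - g2 \<tau>)"
        by (intro ennreal_le_combination3 Q_nonneg)
    qed
    also have "\<dots> = 4 * c k + 4 * d k + 2 * G"
      by (simp add: nn_integral_add nn_integral_cmult c_def d_def G_def)
    finally show ?thesis
      by (simp add: add_left_mono mult_left_mono)
  qed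
  have "(\<lambda>k. 4 * a k + 4 * b k + 2 * (4 * c k + 4 * d k + 2 * G))
      \<longlonglongrightarrow> 4 * 0 + 4 * 0 + 2 * (4 * 0 + 4 * 0 + 2 * G)"
    by (intro tendsto_add ennreal_tendsto_cmult lim tendsto_const) auto
  then have "(\<integral>\<^sup>+\<omega>. ennreal ((X1 \<omega> - X2 \<omega>)\<^sup>2) \<partial>M) \<le> 4 * 0 + 4 * 0 + 2 * (4 * 0 + 4 * 0 + 2 * G)"
    by (rule LIMSEQ_le_const) (use bound in auto)
  then show ?thesis
    by (simp add: G_def mult.assoc[symmetric])
qed

text \<open>Pairing a step integral with \<open>e m\<close> moves each operator to its adjoint
  acting on \<open>e m\<close>, and \<open>coord\<close> identifies the same pairing for
  \<open>\<Phi> \<tau>\<close> as \<open>\<phi> \<tau> *\<^sub>R e m\<close>. A coordinate is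
  dominated by the trace for the integrands and by the norm for the integrals, so both convergences
  are inherited.\<close>

lemma has_wiener_integral_scalar_approx:
  assumes X: "has_wiener_integral M Q W \<Phi> t X" and t: "t \<ge> 0"
    and e: "orthonormal_basis e"
    and bl: "\<And>\<tau>. 0 \<le> \<tau> \<Longrightarrow> \<tau> \<le> t \<Longrightarrow> bounded_linear (\<Phi> \<tau>)"
    and coord: "\<And>\<tau> x. 0 \<le> \<tau> \<Longrightarrow> \<tau> \<le> t \<Longrightarrow> \<Phi> \<tau> x \<bullet> e m = \<phi> \<tau> * (x \<bullet> e m)"
    and \<phi>: "\<phi> \<in> borel_measurable borel"
  shows "\<exists>xs. scalar_approx xs (\<lambda>\<tau>. (indicator {0..t} \<tau> * \<phi> \<tau>) *\<^sub>R e m) (\<lambda>\<omega>. X \<omega> \<bullet> e m)"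
proof -
  obtain n s B where step: "\<And>k. is_step t (n k) (s k) (B k)"
    and lim1: "(\<lambda>k. \<integral>\<^sup>+\<tau>\<in>{0..t}.
           (let S = (\<lambda>x. step_op (n k) (s k) (B k) \<tau> x - \<Phi> \<tau> x)
            in pos_trace (S \<circ> Q \<circ> adjoint S)) \<partial>lborel) \<longlonglongrightarrow> 0"
    and lim2: "(\<lambda>k. \<integral>\<^sup>+\<omega>. ennreal ((norm (step_integral W (n k) (s k) (B k) \<omega> - X \<omega>))\<^sup>2) \<partial>M) \<longlonglongrightarrow> 0"
    using X unfolding has_wiener_integral_def by blast
  have [measurable]: "X \<in> borel_measurable M"
    using X by (simp add: has_wiener_integral_def)
  define xs where "xs k = map (\<lambda>i. (s k i, s k (Suc i), adjoint (B k i) (e m))) [0..<n k]" for k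
  have s_bounds: "0 \<le> s k i" "s k i \<le> s k (Suc i)" "s k (Suc i) \<le> t" if "i < n k" for k i
    using that is_step_mono[OF step, of 0 i k] is_step_mono[OF step, of i "Suc i" k]
      is_step_mono[OF step, of "Suc i" "n k" k] step[of k] by (auto simp: is_step_def)
  have B_bl: "bounded_linear (B k i)" if "i < n k" for k i
    using that step[of k] by (simp add: is_step_def)
  have adj: "B k i x \<bullet> e m = x \<bullet> adjoint (B k i) (e m)" if "i < n k" for k i x
    by (rule inner_adjoint[OF B_bl[OF that] e])
  have f: "elem_fun (xs k) \<tau> = (\<Sum>i<n k. indicator {s k i<..s k (Suc i)} \<tau> *\<^sub>R adjoint (B k i) (e m))"
    for k \<tau>
    by (simp add: elem_fun_def xs_def comp_def interv_sum_list_conv_sum_set_nat atLeast0LessThan)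
  have I: "elem_integral W (xs k) \<omega> = step_integral W (n k) (s k) (B k) \<omega> \<bullet> e m" for k \<omega>
    by (simp add: elem_integral_def xs_def comp_def interv_sum_list_conv_sum_set_nat
        atLeast0LessThan step_integral_def inner_sum_left adj)
  let ?g = "\<lambda>\<tau>. (indicator {0..t} \<tau> * \<phi> \<tau>) *\<^sub>R e m"
  let ?d = "\<lambda>k \<tau>. elem_fun (xs k) \<tau> - ?g \<tau>"
  have le1: "ennreal (Q (?d k \<tau>) \<bullet> ?d k \<tau>)
      \<le> (let S = (\<lambda>x. step_op (n k) (s k) (B k) \<tau> x - \<Phi> \<tau> x)
         in pos_trace (S \<circ> Q \<circ> adjoint S)) * indicator {0..t} \<tau>" for k \<tau>
  proof (cases "\<tau> \<in> {0..t}")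
    case True
    let ?S = "\<lambda>x. step_op (n k) (s k) (B k) \<tau> x - \<Phi> \<tau> x"
    have "bounded_linear ?S"
      unfolding step_op_def using True
      by (intro bounded_linear_sub bounded_linear_sum bounded_linear_const_scaleR B_bl bl) auto
    moreover have "?S x \<bullet> e m = x \<bullet> ?d k \<tau>" for x
      using True coord[of \<tau> x]
      by (simp add: f step_op_def inner_diff_left inner_diff_right inner_sum_left inner_sum_right adj)
    ultimately have "ennreal (Q (?d k \<tau>) \<bullet> ?d k \<tau>) \<le> pos_trace (?S \<circ> Q \<circ> adjoint ?S)"
      by (rule quadratic_le_pos_trace[OF e])
    with True show ?thesis by (simp add: Let_def)
  next
    \<comment> \<open>The elementary isometry integrates over the whole line. The partition lies in
      \<open>[0, t]\<close>, so outside it both the elementary integrand and the kernel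
      vanish.\<close>
    case False
    have "elem_fun (xs k) \<tau> = 0"
      unfolding f using False s_bounds[of _ k]
      by (intro sum.neutral) (force simp: indicator_def)
    with False show ?thesis
      using linear_0[OF bounded_linear.linear[OF Q_bounded_linear]] by simp
  qed
  have le2: "ennreal ((elem_integral W (xs k) \<omega> - X \<omega> \<bullet> e m)\<^sup>2)
      \<le> ennreal ((norm (step_integral W (n k) (s k) (B k) \<omega> - X \<omega>))\<^sup>2)" for k \<omega>
    unfolding I inner_diff_left[symmetric] by (intro ennreal_leI inner_square_le_norm_square e)
  have "scalar_approx xs ?g (\<lambda>\<omega>. X \<omega> \<bullet> e m)"
    unfolding scalar_approx_def
  proof (intro conjI allI)
    show "elem_valid (xs k)" for k
      using s_bounds by (auto simp: elem_valid_def xs_def)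
    show "?g \<in> borel_measurable borel"
      using \<phi> by measurable
    show "(\<lambda>\<omega>. X \<omega> \<bullet> e m) \<in> borel_measurable M" by simp
    show "(\<lambda>k. \<integral>\<^sup>+\<tau>. ennreal (Q (?d k \<tau>) \<bullet> ?d k \<tau>) \<partial>lborel) \<longlonglongrightarrow> 0"
      by (rule tendsto_sandwich[OF _ _ tendsto_const lim1])
        (auto intro!: always_eventually nn_integral_mono le1)
    show "(\<lambda>k. \<integral>\<^sup>+\<omega>. ennreal ((elem_integral W (xs k) \<omega> - X \<omega> \<bullet> e m)\<^sup>2) \<partial>M) \<longlonglongrightarrow> 0"
      by (rule tendsto_sandwich[OF _ _ tendsto_const lim2])
        (auto intro!: always_eventually nn_integral_mono le2)
  qed
  then show ?thesis by blast
qed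

end

section \<open>The stochastic convolution\<close>

text \<open>Weakening the Lipschitz constant \<open>\<mu>\<close> to \<open>1 + \<mu>\<close>
  produces exactly the factor that the weights \<open>1 / (1 + \<mu> n)\<close> cancel
  later.\<close>

lemma exp_decay_diff_square_le:
  fixes s t \<mu> :: real
  assumes "0 \<le> s" "s \<le> t" "0 < \<mu>"
  shows "(exp (- \<mu> * t) - exp (- \<mu> * s))\<^sup>2 \<le> (1 + \<mu>)\<^sup>2 * (t - s)\<^sup>2"
proof -
  have "exp (- \<mu> * s) - exp (- \<mu> * t) = exp (- \<mu> * s) * (1 - exp (- \<mu> * (t - s)))"
    by (simp add: algebra_simps exp_add[symmetric])
  also have "\<dots> \<le> 1 * (\<mu> * (t - s))"
    using assms exp_ge_add_one_self[of "- \<mu> * (t - s)"]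
    by (intro mult_mono) (auto simp: mult_nonneg_nonneg)
  also have "\<dots> \<le> (1 + \<mu>) * (t - s)"
    using assms by (simp add: algebra_simps)
  finally have "exp (- \<mu> * s) - exp (- \<mu> * t) \<le> (1 + \<mu>) * (t - s)" .
  moreover have "exp (- \<mu> * t) \<le> exp (- \<mu> * s)"
    using assms by simp
  ultimately have "(exp (- \<mu> * s) - exp (- \<mu> * t))\<^sup>2 \<le> ((1 + \<mu>) * (t - s))\<^sup>2"
    by (intro power_mono) auto
  then show ?thesis
    by (simp add: power_mult_distrib power2_commute)
qed

text \<open>Up to \<open>t1\<close> both kernels are present and their difference is Lipschitz in
  time. After \<open>t1\<close> only the later kernel remains, and it is merely bounded by 1; this
  piece contributes the first power of \<open>t2 - t1\<close> on integration.\<close>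

lemma convolution_kernel_diff_square_le:
  fixes t1 t2 \<mu> \<tau> :: real
  assumes t: "0 \<le> t1" "t1 \<le> t2" and \<mu>: "0 < \<mu>"
  shows "(indicator {0..t2} \<tau> * exp (- \<mu> * (t2 - \<tau>)) - indicator {0..t1} \<tau> * exp (- \<mu> * (t1 - \<tau>)))\<^sup>2
    \<le> (1 + \<mu>)\<^sup>2 * ((t2 - t1)\<^sup>2 * indicator {0..t1} \<tau> + indicator {t1..t2} \<tau>)"
proof -
  consider "\<tau> \<in> {0..t1}" | "\<tau> \<in> {t1<..t2}" | "\<tau> < 0" | "\<tau> > t2"
    by (meson atLeastAtMost_iff greaterThanAtMost_iff not_le)
  then show ?thesis
  proof cases
    case 1
    have "(exp (- \<mu> * (t2 - \<tau>)) - exp (- \<mu> * (t1 - \<tau>)))\<^sup>2 \<le> (1 + \<mu>)\<^sup>2 * (t2 - t1)\<^sup>2"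
      using 1 t \<mu> exp_decay_diff_square_le[of "t1 - \<tau>" "t2 - \<tau>" \<mu>] by simp
    also have "\<dots> \<le> (1 + \<mu>)\<^sup>2 * ((t2 - t1)\<^sup>2 * indicator {0..t1} \<tau> + indicator {t1..t2} \<tau>)"
      using 1 by (intro mult_left_mono) auto
    finally show ?thesis
      using 1 t by simp
  next
    case 2
    then have "(exp (- \<mu> * (t2 - \<tau>)))\<^sup>2 \<le> 1"
      using \<mu> by (intro power_le_one) auto
    also have "\<dots> \<le> (1 + \<mu>)\<^sup>2"
      using \<mu> by (intro one_le_power) auto
    finally show ?thesis
      using 2 t by (simp add: indicator_def)
  qed (use t in \<open>auto simp: indicator_def\<close>)
qed

lemma convolution_kernel_diff_integral_le:
  fixes t1 t2 \<mu> :: real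
  assumes t: "0 \<le> t1" "t1 \<le> t2" and \<mu>: "0 < \<mu>"
  shows "(\<integral>\<^sup>+\<tau>. ennreal ((indicator {0..t2} \<tau> * exp (- \<mu> * (t2 - \<tau>))
      - indicator {0..t1} \<tau> * exp (- \<mu> * (t1 - \<tau>)))\<^sup>2) \<partial>lborel)
    \<le> ennreal ((1 + \<mu>)\<^sup>2 * ((t2 - t1)\<^sup>2 * t1 + (t2 - t1)))"
proof -
  have "(\<integral>\<^sup>+\<tau>. ennreal ((indicator {0..t2} \<tau> * exp (- \<mu> * (t2 - \<tau>))
      - indicator {0..t1} \<tau> * exp (- \<mu> * (t1 - \<tau>)))\<^sup>2) \<partial>lborel)
    \<le> (\<integral>\<^sup>+\<tau>. ennreal ((1 + \<mu>)\<^sup>2 * (t2 - t1)\<^sup>2) * indicator {0..t1} \<tau>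
        + ennreal ((1 + \<mu>)\<^sup>2) * indicator {t1..t2} \<tau> \<partial>lborel)"
  proof (rule nn_integral_mono)
    fix \<tau>
    have "ennreal ((indicator {0..t2} \<tau> * exp (- \<mu> * (t2 - \<tau>))
        - indicator {0..t1} \<tau> * exp (- \<mu> * (t1 - \<tau>)))\<^sup>2)
      \<le> ennreal ((1 + \<mu>)\<^sup>2 * ((t2 - t1)\<^sup>2 * indicator {0..t1} \<tau> + indicator {t1..t2} \<tau>))"
      by (intro ennreal_leI convolution_kernel_diff_square_le assms)
    also have "\<dots> = ennreal ((1 + \<mu>)\<^sup>2 * (t2 - t1)\<^sup>2) * indicator {0..t1} \<tau>
        + ennreal ((1 + \<mu>)\<^sup>2) * indicator {t1..t2} \<tau>"
      by (auto simp: indicator_def ennreal_plus[symmetric] algebra_simps simp del: ennreal_plus)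
    finally show "ennreal ((indicator {0..t2} \<tau> * exp (- \<mu> * (t2 - \<tau>))
        - indicator {0..t1} \<tau> * exp (- \<mu> * (t1 - \<tau>)))\<^sup>2)
      \<le> ennreal ((1 + \<mu>)\<^sup>2 * (t2 - t1)\<^sup>2) * indicator {0..t1} \<tau>
        + ennreal ((1 + \<mu>)\<^sup>2) * indicator {t1..t2} \<tau>" .
  qed
  also have "\<dots> = ennreal ((1 + \<mu>)\<^sup>2 * (t2 - t1)\<^sup>2) * ennreal t1
      + ennreal ((1 + \<mu>)\<^sup>2) * ennreal (t2 - t1)"
    using t by (simp add: nn_integral_add nn_integral_cmult_indicator)
  also have "\<dots> = ennreal ((1 + \<mu>)\<^sup>2 * (t2 - t1)\<^sup>2 * t1 + (1 + \<mu>)\<^sup>2 * (t2 - t1))"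
    using t by (subst ennreal_plus) (simp_all add: ennreal_mult)
  also have "(1 + \<mu>)\<^sup>2 * (t2 - t1)\<^sup>2 * t1 + (1 + \<mu>)\<^sup>2 * (t2 - t1)
      = (1 + \<mu>)\<^sup>2 * ((t2 - t1)\<^sup>2 * t1 + (t2 - t1))"
    by (simp add: algebra_simps)
  finally show ?thesis .
qed

context wiener
begin

lemma semigroup_convolution_approx:
  assumes E: "generated_by_minus A E" and e: "eigenbasis A e \<mu>" and t: "t \<ge> 0"
    and Z: "has_wiener_integral M Q W (\<lambda>\<tau>. E (t - \<tau>)) t Z"
  shows "\<exists>xs. scalar_approx xs (\<lambda>\<tau>. (indicator {0..t} \<tau> * exp (- \<mu> n * (t - \<tau>))) *\<^sub>R e n)
    (\<lambda>\<omega>. Z \<omega> \<bullet> e n)"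
proof (rule has_wiener_integral_scalar_approx[OF Z t])
  show "orthonormal_basis e"
    using e by (simp add: eigenbasis_def)
  fix \<tau> assume \<tau>: "0 \<le> \<tau>" "\<tau> \<le> t"
  then show "bounded_linear (E (t - \<tau>))"
    using E by (simp add: generated_by_minus_def C0_semigroup_def)
  show "E (t - \<tau>) x \<bullet> e n = exp (- \<mu> n * (t - \<tau>)) * (x \<bullet> e n)" for x
    using \<tau> by (intro eigenbasis_semigroup_inner[OF E e]) simp
qed simp

lemma quadratic_scaleR: "Q (c *\<^sub>R x) \<bullet> (c *\<^sub>R x) = c\<^sup>2 * (Q x \<bullet> x)"
proof -
  interpret bounded_linear Q by (rule Q_bounded_linear)
  show ?thesis by (simp add: scaleR power2_eq_square)
qed

text \<open>Each kernel is at most 1 on \<open>[0, t]\<close>, so comparison with the zero integrand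
  gives \<open>4 * t * (Q (e n) \<bullet> e n)\<close> in each coordinate. This controls the
  inhomogeneity in Gronwall's inequality, not the rate.\<close>

lemma convolution_second_moment:
  assumes E: "generated_by_minus A E" and e: "eigenbasis A e \<mu>" and t: "t \<ge> 0"
    and Z: "has_wiener_integral M Q W (\<lambda>\<tau>. E (t - \<tau>)) t Z"
  shows "(\<integral>\<^sup>+\<omega>. ennreal ((norm (Z \<omega>))\<^sup>2) \<partial>M) \<le> 4 * ennreal t * pos_trace Q"
proof -
  have onb: "orthonormal_basis e" and \<mu>: "\<And>n. 0 < \<mu> n"
    using e by (auto simp: eigenbasis_def)
  have [measurable]: "Z \<in> borel_measurable M"
    using Z by (simp add: has_wiener_integral_def)
  have *: "(\<integral>\<^sup>+\<omega>. ennreal ((Z \<omega> \<bullet> e n)\<^sup>2) \<partial>M) \<le> 4 * ennreal t * ennreal (Q (e n) \<bullet> e n)" for n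
  proof -
    let ?\<phi> = "\<lambda>\<tau>. indicator {0..t} \<tau> * exp (- \<mu> n * (t - \<tau>))"
    obtain xs where "scalar_approx xs (\<lambda>\<tau>. ?\<phi> \<tau> *\<^sub>R e n) (\<lambda>\<omega>. Z \<omega> \<bullet> e n)"
      using semigroup_convolution_approx[OF E e t Z] by blast
    from scalar_approx_diff_bound[OF this scalar_approx_zero]
    have "(\<integral>\<^sup>+\<omega>. ennreal ((Z \<omega> \<bullet> e n)\<^sup>2) \<partial>M)
        \<le> 4 * (\<integral>\<^sup>+\<tau>. ennreal ((?\<phi> \<tau>)\<^sup>2 * (Q (e n) \<bullet> e n)) \<partial>lborel)"
      by (simp only: diff_zero quadratic_scaleR)
    also have "\<dots> \<le> 4 * (\<integral>\<^sup>+\<tau>. ennreal (Q (e n) \<bullet> e n) * indicator {0..t} \<tau> \<partial>lborel)"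
      using \<mu>[of n] Q_nonneg
      by (intro mult_left_mono nn_integral_mono)
        (auto simp: indicator_def intro!: ennreal_leI mult_left_le_one_le power_le_one)
    also have "\<dots> = 4 * ennreal t * ennreal (Q (e n) \<bullet> e n)"
      using t by (subst nn_integral_cmult_indicator) (simp_all add: mult_ac)
    finally show ?thesis .
  qed
  have "(\<integral>\<^sup>+\<omega>. ennreal ((norm (Z \<omega>))\<^sup>2) \<partial>M) = (\<Sum>n. \<integral>\<^sup>+\<omega>. ennreal ((Z \<omega> \<bullet> e n)\<^sup>2) \<partial>M)"
    unfolding parseval[OF onb, symmetric] by (intro nn_integral_suminf) simp
  also have "\<dots> \<le> (\<Sum>n. 4 * ennreal t * ennreal (Q (e n) \<bullet> e n))"
    by (intro suminf_le * summableI)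
  also have "\<dots> = 4 * ennreal t * pos_trace Q"
    by (simp add: pos_trace_eq_suminf[OF onb] ennreal_suminf_cmult)
  finally show ?thesis .
qed

text \<open>The division by \<open>1 + \<mu> n\<close> is carried out before summation: it removes
  the growth of the kernel bound in \<open>n\<close>, and a common factor times the trace of
  \<open>Q\<close> is left.\<close>

lemma convolution_increment_second_moment:
  assumes E: "generated_by_minus A E" and e: "eigenbasis A e \<mu>" and t: "0 \<le> t1" "t1 \<le> t2"
    and Z1: "has_wiener_integral M Q W (\<lambda>\<tau>. E (t1 - \<tau>)) t1 Z1"
    and Z2: "has_wiener_integral M Q W (\<lambda>\<tau>. E (t2 - \<tau>)) t2 Z2"
  shows "(\<integral>\<^sup>+\<omega>. (\<Sum>n. ennreal ((((Z2 \<omega> - Z1 \<omega>) \<bullet> e n) / (1 + \<mu> n))\<^sup>2)) \<partial>M)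
    \<le> 4 * ennreal ((t2 - t1)\<^sup>2 * t1 + (t2 - t1)) * pos_trace Q"
proof -
  have onb: "orthonormal_basis e" and \<mu>: "\<And>n. 0 < \<mu> n"
    using e by (auto simp: eigenbasis_def)
  have [measurable]: "Z1 \<in> borel_measurable M" "Z2 \<in> borel_measurable M"
    using Z1 Z2 by (auto simp: has_wiener_integral_def)
  define r where "r = (t2 - t1)\<^sup>2 * t1 + (t2 - t1)"
  have r: "0 \<le> r" using t by (simp add: r_def)
  have *: "(\<integral>\<^sup>+\<omega>. ennreal ((((Z2 \<omega> - Z1 \<omega>) \<bullet> e n) / (1 + \<mu> n))\<^sup>2) \<partial>M)
      \<le> 4 * ennreal r * ennreal (Q (e n) \<bullet> e n)" for n
  proof -
    define q where "q = Q (e n) \<bullet> e n"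
    have q: "0 \<le> q" by (simp add: q_def Q_nonneg)
    define \<phi> where "\<phi> t \<tau> = indicator {0..t} \<tau> * exp (- \<mu> n * (t - \<tau>))" for t \<tau>
    obtain xs where xs: "scalar_approx xs (\<lambda>\<tau>. \<phi> t1 \<tau> *\<^sub>R e n) (\<lambda>\<omega>. Z1 \<omega> \<bullet> e n)"
      using semigroup_convolution_approx[OF E e _ Z1] t unfolding \<phi>_def by blast
    have "0 \<le> t2" using t by simp
    then obtain ys where ys: "scalar_approx ys (\<lambda>\<tau>. \<phi> t2 \<tau> *\<^sub>R e n) (\<lambda>\<omega>. Z2 \<omega> \<bullet> e n)"
      using semigroup_convolution_approx[OF E e _ Z2] unfolding \<phi>_def by blast
    have "(\<integral>\<^sup>+\<omega>. ennreal (((Z2 \<omega> - Z1 \<omega>) \<bullet> e n)\<^sup>2) \<partial>M)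
        \<le> 4 * (\<integral>\<^sup>+\<tau>. ennreal ((\<phi> t2 \<tau> - \<phi> t1 \<tau>)\<^sup>2 * q) \<partial>lborel)"
      using scalar_approx_diff_bound[OF ys xs]
      by (simp only: inner_diff_left scaleR_diff_left[symmetric] quadratic_scaleR q_def)
    also have "(\<integral>\<^sup>+\<tau>. ennreal ((\<phi> t2 \<tau> - \<phi> t1 \<tau>)\<^sup>2 * q) \<partial>lborel)
        = (\<integral>\<^sup>+\<tau>. ennreal ((\<phi> t2 \<tau> - \<phi> t1 \<tau>)\<^sup>2) \<partial>lborel) * ennreal q"
      unfolding \<phi>_def using q
      by (subst nn_integral_multc[symmetric]) (simp_all add: ennreal_mult)
    also have "\<dots> \<le> ennreal ((1 + \<mu> n)\<^sup>2 * r) * ennreal q"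
      unfolding \<phi>_def r_def
      by (intro mult_right_mono convolution_kernel_diff_integral_le t \<mu>) simp
    also have "\<dots> = ennreal ((1 + \<mu> n)\<^sup>2 * r * q)"
      using r q by (simp add: ennreal_mult)
    finally have le: "(\<integral>\<^sup>+\<omega>. ennreal (((Z2 \<omega> - Z1 \<omega>) \<bullet> e n)\<^sup>2) \<partial>M)
        \<le> 4 * ennreal ((1 + \<mu> n)\<^sup>2 * r * q)"
      by (simp add: mult_left_mono)
    have "(\<integral>\<^sup>+\<omega>. ennreal ((((Z2 \<omega> - Z1 \<omega>) \<bullet> e n) / (1 + \<mu> n))\<^sup>2) \<partial>M)
        = (\<integral>\<^sup>+\<omega>. ennreal (1 / (1 + \<mu> n)\<^sup>2) * ennreal (((Z2 \<omega> - Z1 \<omega>) \<bullet> e n)\<^sup>2) \<partial>M)"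
      by (simp add: ennreal_mult[symmetric] power_divide)
    also have "\<dots> = ennreal (1 / (1 + \<mu> n)\<^sup>2) * (\<integral>\<^sup>+\<omega>. ennreal (((Z2 \<omega> - Z1 \<omega>) \<bullet> e n)\<^sup>2) \<partial>M)"
      by (intro nn_integral_cmult) simp
    also have "\<dots> \<le> ennreal (1 / (1 + \<mu> n)\<^sup>2) * (4 * ennreal ((1 + \<mu> n)\<^sup>2 * r * q))"
      by (intro mult_left_mono le) simp
    also have "\<dots> = 4 * ennreal (1 / (1 + \<mu> n)\<^sup>2 * ((1 + \<mu> n)\<^sup>2 * r * q))"
      using r q by (simp add: ennreal_mult[symmetric] mult.left_commute)
    also have "1 / (1 + \<mu> n)\<^sup>2 * ((1 + \<mu> n)\<^sup>2 * r * q) = r * q"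
      using \<mu>[of n] by (simp add: add_pos_pos less_imp_neq[THEN not_sym])
    also have "4 * ennreal (r * q) = 4 * ennreal r * ennreal q"
      using r q by (simp add: ennreal_mult mult.assoc)
    finally show ?thesis by (simp add: q_def)
  qed
  have "(\<integral>\<^sup>+\<omega>. (\<Sum>n. ennreal ((((Z2 \<omega> - Z1 \<omega>) \<bullet> e n) / (1 + \<mu> n))\<^sup>2)) \<partial>M)
      = (\<Sum>n. \<integral>\<^sup>+\<omega>. ennreal ((((Z2 \<omega> - Z1 \<omega>) \<bullet> e n) / (1 + \<mu> n))\<^sup>2) \<partial>M)"
    by (intro nn_integral_suminf) simp
  also have "\<dots> \<le> (\<Sum>n. 4 * ennreal r * ennreal (Q (e n) \<bullet> e n))"
    by (intro suminf_le * summableI)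
  also have "\<dots> = 4 * ennreal r * pos_trace Q"
    by (simp add: pos_trace_eq_suminf[OF onb] ennreal_suminf_cmult)
  finally show ?thesis by (simp add: r_def)
qed

end

section \<open>Gronwall's inequality in mean square\<close>

text \<open>Integrating against the weight \<open>exp (- 2 K t)\<close> turns the Volterra term into at most half of
  the left-hand side, which can be absorbed since it is finite.\<close>

lemma nn_integral_gronwall:
  fixes x a :: "real \<Rightarrow> ennreal" and K T :: real
  assumes [measurable]: "x \<in> borel_measurable borel" "a \<in> borel_measurable borel"
    and K: "K > 0" and T: "T \<ge> 0"
    and fin: "(\<integral>\<^sup>+t\<in>{0..T}. x t \<partial>lborel) < \<infinity>"
    and le: "\<And>t. 0 \<le> t \<Longrightarrow> t \<le> T \<Longrightarrow> x t \<le> a t + ennreal K * (\<integral>\<^sup>+s\<in>{0..t}. x s \<partial>lborel)"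
  shows "(\<integral>\<^sup>+t\<in>{0..T}. x t \<partial>lborel) \<le> ennreal (2 * exp (2 * K * T)) * (\<integral>\<^sup>+t\<in>{0..T}. a t \<partial>lborel)"
proof -
  define w where "w t = exp (- 2 * K * t)" for t
  have [measurable]: "w \<in> borel_measurable borel" unfolding w_def by measurable
  have w_le: "ennreal (w t) * y \<le> y" if "t \<ge> 0" for t y
    using that K mult_right_mono[of "ennreal (w t)" 1 y] by (simp add: w_def)
  define X where "X = (\<integral>\<^sup>+t\<in>{0..T}. ennreal (w t) * x t \<partial>lborel)"
  define Y where "Y = (\<integral>\<^sup>+t\<in>{0..T}. a t \<partial>lborel)"
  have "X \<le> (\<integral>\<^sup>+t\<in>{0..T}. x t \<partial>lborel)"
    unfolding X_def by (intro nn_integral_mono) (auto simp: indicator_def intro!: w_le)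
  with fin have Xfin: "X < \<infinity>" by simp
  \<comment> \<open>The decay rate \<open>2 * K\<close> of the weight yields
    \<open>1 / (2 * K)\<close>, which together with the factor \<open>K\<close> of the Volterra term
    gives the half that is absorbed.\<close>
  have tail: "(\<integral>\<^sup>+t. ennreal (w t) * indicator {s..T} t \<partial>lborel) \<le> ennreal (w s / (2 * K))" for s
  proof (cases "s \<le> T")
    case True
    have "(\<integral>\<^sup>+t. ennreal (w t) * indicator {s..T} t \<partial>lborel) = ennreal (- w T / (2 * K) - (- w s / (2 * K)))"
      using True K
      by (intro nn_integral_FTC_Icc) (auto simp: w_def intro!: derivative_eq_intros)
    also have "\<dots> \<le> ennreal (w s / (2 * K))"
      using K by (intro ennreal_leI) (simp add: w_def)
    finally show ?thesis .
  qed simp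
  \<comment> \<open>The region \<open>0 \<le> s \<le> t \<le> T\<close> is written as
    \<open>s \<in> {0..T}\<close>, \<open>t \<in> {s..T}\<close>, ready for exchanging the order of
    integration.\<close>
  have "X \<le> (\<integral>\<^sup>+t. a t * indicator {0..T} t
      + ennreal K * (\<integral>\<^sup>+s. ennreal (w t) * indicator {s..T} t * (x s * indicator {0..T} s) \<partial>lborel) \<partial>lborel)"
    unfolding X_def
  proof (rule nn_integral_mono)
    fix t
    show "ennreal (w t) * x t * indicator {0..T} t \<le> a t * indicator {0..T} t
      + ennreal K * (\<integral>\<^sup>+s. ennreal (w t) * indicator {s..T} t * (x s * indicator {0..T} s) \<partial>lborel)"
    proof (cases "t \<in> {0..T}")
      case True
      have "ennreal (w t) * x t \<le> ennreal (w t) * (a t + ennreal K * (\<integral>\<^sup>+s\<in>{0..t}. x s \<partial>lborel))"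
        using True by (intro mult_left_mono le) auto
      also have "\<dots> = ennreal (w t) * a t + ennreal K * (ennreal (w t) * (\<integral>\<^sup>+s\<in>{0..t}. x s \<partial>lborel))"
        by (simp add: distrib_left mult_ac)
      also have "\<dots> \<le> a t + ennreal K * (ennreal (w t) * (\<integral>\<^sup>+s\<in>{0..t}. x s \<partial>lborel))"
        using True by (intro add_right_mono w_le) auto
      also have "ennreal (w t) * (\<integral>\<^sup>+s\<in>{0..t}. x s \<partial>lborel)
          = (\<integral>\<^sup>+s. ennreal (w t) * indicator {s..T} t * (x s * indicator {0..T} s) \<partial>lborel)"
        using True by (subst nn_integral_cmult[symmetric])
          (auto intro!: nn_integral_cong simp: indicator_def)
      finally show ?thesis using True by simp
    qed simp
  qed
  also have "\<dots> = Y + ennreal K * (\<integral>\<^sup>+t. (\<integral>\<^sup>+s. ennreal (w t) * indicator {s..T} t * (x s * indicator {0..T} s) \<partial>lborel) \<partial>lborel)"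
    unfolding Y_def indicator_def atLeastAtMost_iff
    by (subst nn_integral_add, simp, simp, subst nn_integral_cmult) simp_all
  also have "(\<integral>\<^sup>+t. (\<integral>\<^sup>+s. ennreal (w t) * indicator {s..T} t * (x s * indicator {0..T} s) \<partial>lborel) \<partial>lborel)
      = (\<integral>\<^sup>+s. (\<integral>\<^sup>+t. ennreal (w t) * indicator {s..T} t * (x s * indicator {0..T} s) \<partial>lborel) \<partial>lborel)"
    unfolding indicator_def atLeastAtMost_iff
    by (intro lborel_pair.Fubini') simp
  also have "\<dots> = (\<integral>\<^sup>+s. (\<integral>\<^sup>+t. ennreal (w t) * indicator {s..T} t \<partial>lborel) * (x s * indicator {0..T} s) \<partial>lborel)"
    by (intro nn_integral_cong nn_integral_multc) simp
  also have "\<dots> \<le> (\<integral>\<^sup>+s. ennreal (w s / (2 * K)) * (x s * indicator {0..T} s) \<partial>lborel)"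
    by (intro nn_integral_mono mult_right_mono tail) simp
  also have "\<dots> = (\<integral>\<^sup>+s. ennreal (1 / (2 * K)) * (ennreal (w s) * x s * indicator {0..T} s) \<partial>lborel)"
    using K by (intro nn_integral_cong)
      (simp add: mult.assoc[symmetric] ennreal_mult[symmetric] w_def)
  also have "\<dots> = ennreal (1 / (2 * K)) * X"
    unfolding X_def by (intro nn_integral_cmult) simp
  also have "ennreal K * (ennreal (1 / (2 * K)) * X) = ennreal (1 / 2) * X"
    using K by (simp add: mult.assoc[symmetric] ennreal_mult[symmetric])
  finally have XY: "X \<le> Y + ennreal (1 / 2) * X"
    by (simp add: add_left_mono mult_left_mono)
  \<comment> \<open>Half of \<open>X\<close> may be subtracted because \<open>X\<close> is finite;
    for infinite \<open>Y\<close> there is nothing to show.\<close>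
  have "X \<le> 2 * Y"
  proof (cases Y)
    case (real y)
    obtain r where r: "X = ennreal r" "r \<ge> 0"
      using Xfin by (cases X) auto
    have "ennreal (y + 1 / 2 * r) = ennreal y + ennreal (1 / 2 * r)"
      using real r by (intro ennreal_plus) auto
    also have "ennreal (1 / 2 * r) = ennreal (1 / 2) * ennreal r"
      using r by (intro ennreal_mult) auto
    finally have "ennreal (y + 1 / 2 * r) = ennreal y + ennreal (1 / 2) * ennreal r" .
    with XY real r have "ennreal r \<le> ennreal (y + 1 / 2 * r)"
      by (simp only:)
    moreover have "0 \<le> y + 1 / 2 * r" using real r by simp
    ultimately have "r \<le> y + 1 / 2 * r" by (simp only: ennreal_le_iff)
    then have "r \<le> 2 * y" by simp
    then have "ennreal r \<le> ennreal (2 * y)" by (rule ennreal_leI)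
    then show ?thesis
      using real r by (simp add: ennreal_mult)
  qed (simp add: ennreal_mult_top)
  \<comment> \<open>On \<open>[0, T]\<close> the weight is at least
    \<open>exp (- 2 * K * T)\<close>, so removing it costs the factor
    \<open>exp (2 * K * T)\<close>.\<close>
  have "(\<integral>\<^sup>+t\<in>{0..T}. x t \<partial>lborel) \<le> (\<integral>\<^sup>+t. ennreal (exp (2 * K * T)) * (ennreal (w t) * x t * indicator {0..T} t) \<partial>lborel)"
  proof (rule nn_integral_mono)
    fix t
    show "x t * indicator {0..T} t \<le> ennreal (exp (2 * K * T)) * (ennreal (w t) * x t * indicator {0..T} t)"
    proof (cases "t \<in> {0..T}")
      case True
      then have "1 \<le> exp (2 * K * T) * w t"
        using K by (simp add: w_def exp_add[symmetric])
      then have "1 * x t \<le> ennreal (exp (2 * K * T) * w t) * x t"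
        by (intro mult_right_mono) (simp_all add: ennreal_leI flip: ennreal_1)
      then show ?thesis
        using True by (simp add: ennreal_mult w_def mult.assoc)
    qed simp
  qed
  also have "\<dots> = ennreal (exp (2 * K * T)) * X"
    unfolding X_def by (intro nn_integral_cmult) simp
  also have "\<dots> \<le> ennreal (exp (2 * K * T)) * (2 * Y)"
    by (intro mult_left_mono \<open>X \<le> 2 * Y\<close>) simp
  also have "\<dots> = ennreal (2 * exp (2 * K * T)) * Y"
    by (simp add: ennreal_mult mult_ac)
  finally show ?thesis by (simp add: Y_def)
qed

section \<open>Second moments from a pathwise Volterra inequality\<close>

lemma set_nn_integral_square_le:
  fixes a :: "real \<Rightarrow> ennreal"
  assumes [measurable]: "a \<in> borel_measurable borel" and "s \<le> t"
  shows "(\<integral>\<^sup>+\<tau>\<in>{s..t}. a \<tau> \<partial>lborel)\<^sup>2 \<le> ennreal (t - s) * (\<integral>\<^sup>+\<tau>\<in>{s..t}. (a \<tau>)\<^sup>2 \<partial>lborel)"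
proof -
  have "(\<integral>\<^sup>+\<tau>\<in>{s..t}. a \<tau> \<partial>lborel)\<^sup>2
      = (\<integral>\<^sup>+\<tau>. indicator {s..t} \<tau> * (a \<tau> * indicator {s..t} \<tau>) \<partial>lborel)\<^sup>2"
    by (intro arg_cong[where f="\<lambda>x. x\<^sup>2"] nn_integral_cong) (simp add: indicator_def)
  also have "\<dots> \<le> (\<integral>\<^sup>+\<tau>. (indicator {s..t} \<tau>)\<^sup>2 \<partial>lborel) * (\<integral>\<^sup>+\<tau>. (a \<tau> * indicator {s..t} \<tau>)\<^sup>2 \<partial>lborel)"
    by (intro Cauchy_Schwarz_nn_integral) simp_all
  also have "(\<integral>\<^sup>+\<tau>. (indicator {s..t} \<tau>)\<^sup>2 \<partial>lborel) = (\<integral>\<^sup>+\<tau>. indicator {s..t} \<tau> \<partial>lborel)"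
    by (intro nn_integral_cong) (simp add: indicator_def)
  also have "\<dots> = ennreal (t - s)"
    using assms(2) by simp
  also have "(\<integral>\<^sup>+\<tau>. (a \<tau> * indicator {s..t} \<tau>)\<^sup>2 \<partial>lborel) = (\<integral>\<^sup>+\<tau>\<in>{s..t}. (a \<tau>)\<^sup>2 \<partial>lborel)"
    by (intro nn_integral_cong) (simp add: indicator_def)
  finally show ?thesis .
qed

lemma ennreal_power2_add_le: "(x + y)\<^sup>2 \<le> 2 * x\<^sup>2 + 2 * (y\<^sup>2 :: ennreal)"
proof (cases x; cases y)
  fix r s assume rs: "x = ennreal r" "0 \<le> r" "y = ennreal s" "0 \<le> s"
  have "(r + s)\<^sup>2 \<le> 2 * r\<^sup>2 + 2 * s\<^sup>2"
    using sum_squares_bound[of r s] by (simp add: power2_sum)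
  then have "ennreal ((r + s)\<^sup>2) \<le> ennreal (2 * r\<^sup>2 + 2 * s\<^sup>2)"
    by (rule ennreal_leI)
  then show ?thesis
    using rs by (simp add: ennreal_power[symmetric] ennreal_mult)
qed (simp_all add: ennreal_mult_top power2_eq_square)

text \<open>The excess \<open>x t - K \<integral>\<^sub>0\<^sup>t x\<close> serves as the inhomogeneity of Gronwall's inequality: unlike the
  inhomogeneity it is compared with in applications, it is jointly measurable.\<close>

lemma expected_square_gronwall:
  fixes x :: "real \<Rightarrow> 'w \<Rightarrow> ennreal" and K T :: real
  assumes "prob_space M"
    and x: "(\<lambda>(t, \<omega>). x t \<omega>) \<in> borel_measurable (borel \<Otimes>\<^sub>M M)"
    and K: "K > 0" and T: "T \<ge> 0"
    and fin: "AE \<omega> in M. (\<integral>\<^sup>+t\<in>{0..T}. x t \<omega> \<partial>lborel) < \<infinity>"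
    and C: "C < \<infinity>"
      "\<And>t. 0 \<le> t \<Longrightarrow> t \<le> T \<Longrightarrow> (\<integral>\<^sup>+\<omega>. (x t \<omega> - ennreal K * (\<integral>\<^sup>+s\<in>{0..t}. x s \<omega> \<partial>lborel))\<^sup>2 \<partial>M) \<le> C"
  shows "(\<integral>\<^sup>+\<omega>. (\<integral>\<^sup>+t\<in>{0..T}. (x t \<omega>)\<^sup>2 \<partial>lborel) \<partial>M) < \<infinity>"
proof -
  interpret prob_space M by fact
  interpret pair_sigma_finite lborel M ..
  have [measurable]: "(\<lambda>(t, \<omega>). x t \<omega>) \<in> borel_measurable (lborel \<Otimes>\<^sub>M M)"
    using x by (simp cong: measurable_cong_sets sets_pair_measure_cong)
  define a where "a t \<omega> = x t \<omega> - ennreal K * (\<integral>\<^sup>+s\<in>{0..t}. x s \<omega> \<partial>lborel)" for t \<omega>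
  \<comment> \<open>Written as a condition on \<open>s\<close> and \<open>t\<close>, the indicator
    of the moving interval is visibly measurable in both variables.\<close>
  have "(\<lambda>(t, \<omega>). \<integral>\<^sup>+s. x s \<omega> * (if 0 \<le> s \<and> s \<le> t then 1 else 0) \<partial>lborel) \<in> borel_measurable (lborel \<Otimes>\<^sub>M M)"
    by measurable
  then have [measurable]: "(\<lambda>(t, \<omega>). \<integral>\<^sup>+s\<in>{0..t}. x s \<omega> \<partial>lborel) \<in> borel_measurable (lborel \<Otimes>\<^sub>M M)"
    unfolding indicator_def by simp
  have [measurable]: "(\<lambda>(t, \<omega>). a t \<omega>) \<in> borel_measurable (lborel \<Otimes>\<^sub>M M)"
    unfolding a_def by measurable
  define c where "c = ennreal K * ennreal (2 * exp (2 * K * T))"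
  \<comment> \<open>The summand 2 belongs to the square of \<open>a\<close>. The rest belongs to the
    square of the constant \<open>c * I1\<close>: one factor \<open>T\<close> from
    \<open>I1\<^sup>2 \<le> ennreal T * I\<close>, the other from integrating a constant over
    \<open>[0, T]\<close>.\<close>
  define c' where "c' = 2 + ennreal T * (2 * (c\<^sup>2 * ennreal T))"
  have pathwise: "(\<integral>\<^sup>+t\<in>{0..T}. (x t \<omega>)\<^sup>2 \<partial>lborel) \<le> c' * (\<integral>\<^sup>+t\<in>{0..T}. (a t \<omega>)\<^sup>2 \<partial>lborel)"
    if \<omega>: "\<omega> \<in> space M" and fin: "(\<integral>\<^sup>+t\<in>{0..T}. x t \<omega> \<partial>lborel) < \<infinity>" for \<omega>
  proof -
    have [measurable]: "(\<lambda>t. x t \<omega>) \<in> borel_measurable borel" "(\<lambda>t. a t \<omega>) \<in> borel_measurable borel"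
      using \<omega> measurable_compose_Pair1 by (auto intro!: measurable_Pair_compose_split)
    have le: "x t \<omega> \<le> a t \<omega> + ennreal K * (\<integral>\<^sup>+s\<in>{0..t}. x s \<omega> \<partial>lborel)" for t
      unfolding a_def by (metis add.commute ennreal_minus_le_iff order_refl)
    define I where "I = (\<integral>\<^sup>+t\<in>{0..T}. (a t \<omega>)\<^sup>2 \<partial>lborel)"
    define I1 where "I1 = (\<integral>\<^sup>+t\<in>{0..T}. a t \<omega> \<partial>lborel)"
    have I1: "I1\<^sup>2 \<le> ennreal T * I"
      unfolding I1_def I_def using set_nn_integral_square_le[of "\<lambda>t. a t \<omega>" 0 T] T by simp
    have "(\<integral>\<^sup>+t\<in>{0..T}. x t \<omega> \<partial>lborel) \<le> ennreal (2 * exp (2 * K * T)) * I1"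
      unfolding I1_def by (intro nn_integral_gronwall K T fin le) simp_all
    then have c: "ennreal K * (\<integral>\<^sup>+t\<in>{0..T}. x t \<omega> \<partial>lborel) \<le> c * I1"
      unfolding c_def mult.assoc by (rule mult_left_mono) simp
    have "(x t \<omega>)\<^sup>2 * indicator {0..T} t
        \<le> 2 * ((a t \<omega>)\<^sup>2 * indicator {0..T} t) + 2 * (c * I1)\<^sup>2 * indicator {0..T} t" for t
    proof (cases "t \<in> {0..T}")
      case True
      have "ennreal K * (\<integral>\<^sup>+s\<in>{0..t}. x s \<omega> \<partial>lborel) \<le> ennreal K * (\<integral>\<^sup>+s\<in>{0..T}. x s \<omega> \<partial>lborel)"
        using True by (intro mult_left_mono nn_integral_mono) (auto simp: indicator_def)
      also note c
      finally have "a t \<omega> + ennreal K * (\<integral>\<^sup>+s\<in>{0..t}. x s \<omega> \<partial>lborel) \<le> a t \<omega> + c * I1"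
        by (rule add_left_mono)
      with le[of t] have "x t \<omega> \<le> a t \<omega> + c * I1"
        by (rule order_trans)
      then have "(x t \<omega>)\<^sup>2 \<le> (a t \<omega> + c * I1)\<^sup>2"
        by (rule power_mono) simp
      also have "\<dots> \<le> 2 * (a t \<omega>)\<^sup>2 + 2 * (c * I1)\<^sup>2"
        by (rule ennreal_power2_add_le)
      finally show ?thesis using True by simp
    qed simp
    then have "(\<integral>\<^sup>+t\<in>{0..T}. (x t \<omega>)\<^sup>2 \<partial>lborel) \<le>
        (\<integral>\<^sup>+t. 2 * ((a t \<omega>)\<^sup>2 * indicator {0..T} t) + 2 * (c * I1)\<^sup>2 * indicator {0..T} t \<partial>lborel)"
      by (rule nn_integral_mono)
    also have "\<dots> = 2 * I + 2 * (c * I1)\<^sup>2 * ennreal T"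
      using T by (simp add: nn_integral_add nn_integral_cmult I_def nn_integral_cmult_indicator)
    also have "\<dots> \<le> 2 * I + 2 * (c\<^sup>2 * (ennreal T * I)) * ennreal T"
      unfolding power_mult_distrib by (intro add_left_mono mult_right_mono mult_left_mono I1) auto
    also have "\<dots> = c' * I"
      unfolding c'_def distrib_right by (simp add: mult_ac)
    finally show ?thesis by (simp add: I_def)
  qed
  have "(\<integral>\<^sup>+\<omega>. (\<integral>\<^sup>+t\<in>{0..T}. (x t \<omega>)\<^sup>2 \<partial>lborel) \<partial>M)
      \<le> (\<integral>\<^sup>+\<omega>. c' * (\<integral>\<^sup>+t\<in>{0..T}. (a t \<omega>)\<^sup>2 \<partial>lborel) \<partial>M)"
    using fin AE_space by (intro nn_integral_mono_AE, eventually_elim) (rule pathwise)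
  also have "\<dots> = c' * (\<integral>\<^sup>+\<omega>. (\<integral>\<^sup>+t\<in>{0..T}. (a t \<omega>)\<^sup>2 \<partial>lborel) \<partial>M)"
    by (intro nn_integral_cmult) simp
  also have "(\<integral>\<^sup>+\<omega>. (\<integral>\<^sup>+t\<in>{0..T}. (a t \<omega>)\<^sup>2 \<partial>lborel) \<partial>M)
      = (\<integral>\<^sup>+t. (\<integral>\<^sup>+\<omega>. (a t \<omega>)\<^sup>2 * indicator {0..T} t \<partial>M) \<partial>lborel)"
    by (intro Fubini') simp
  also have "\<dots> \<le> (\<integral>\<^sup>+t. C * indicator {0..T} t \<partial>lborel)"
  proof (rule nn_integral_mono)
    fix t
    show "(\<integral>\<^sup>+\<omega>. (a t \<omega>)\<^sup>2 * indicator {0..T} t \<partial>M) \<le> C * indicator {0..T} t"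
      using C(2)[of t] by (cases "t \<in> {0..T}") (auto simp: a_def)
  qed
  also have "\<dots> = C * ennreal T"
    using T by (simp add: nn_integral_cmult_indicator)
  finally have "(\<integral>\<^sup>+\<omega>. (\<integral>\<^sup>+t\<in>{0..T}. (x t \<omega>)\<^sup>2 \<partial>lborel) \<partial>M) \<le> c' * (C * ennreal T)"
    by (simp add: mult_left_mono)
  also have "\<dots> < \<infinity>"
    using C(1) by (simp add: c'_def c_def ennreal_mult_less_top power2_eq_square)
  finally show ?thesis .
qed

section \<open>Increments of the mild solution\<close>

text \<open>The partial sums of the expansion converge pointwise. Measurability of \<open>u\<close>
  and of the integrands of the convolutions thus reduces to scalar formulas, without any joint
  regularity of \<open>E\<close>.\<close>

lemma borel_measurable_coordinates:
  fixes g :: "'x \<Rightarrow> 'h::{real_inner, second_countable_topology}"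
  assumes e: "orthonormal_basis e" and [measurable]: "\<And>n. (\<lambda>x. g x \<bullet> e n) \<in> borel_measurable N"
  shows "g \<in> borel_measurable N"
proof (rule borel_measurable_LIMSEQ_metric)
  show "(\<lambda>x. \<Sum>n<k. (g x \<bullet> e n) *\<^sub>R e n) \<in> borel_measurable N" for k
    by measurable
  show "(\<lambda>k. \<Sum>n<k. (g x \<bullet> e n) *\<^sub>R e n) \<longlonglongrightarrow> g x" for x
    using orthonormal_basis_sums[OF e, of "g x"] by (simp add: sums_def)
qed

text \<open>Contractivity dominates the integrand by \<open>g\<close>, and pairing with
  \<open>e n\<close> commutes with the Bochner integral. The factor with \<open>g\<close> carries
  the larger interval \<open>[0, T]\<close>, so that for two times \<open>t\<close> only the scalar
  kernels differ and can be subtracted.\<close>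

lemma semigroup_convolution_inner:
  fixes E :: "real \<Rightarrow> 'h::{real_inner, banach, second_countable_topology} \<Rightarrow> 'h"
  assumes E: "generated_by_minus A E" and e: "eigenbasis A e \<mu>"
    and t: "0 \<le> t" "t \<le> T" and g: "set_integrable lborel {0..T} g"
  shows "has_bochner_integral lborel
    (\<lambda>\<tau>. (indicator {0..t} \<tau> * exp (- \<mu> n * (t - \<tau>))) * ((indicator {0..T} \<tau> *\<^sub>R g \<tau>) \<bullet> e n))
    ((LINT \<tau>:{0..t}|lborel. E (t - \<tau>) (g \<tau>)) \<bullet> e n)"
proof -
  have onb: "orthonormal_basis e"
    using e by (simp add: eigenbasis_def)
  define G where "G \<tau> = indicator {0..T} \<tau> *\<^sub>R g \<tau>" for \<tau>
  define H where "H \<tau> = indicator {0..t} \<tau> *\<^sub>R E (t - \<tau>) (g \<tau>)" for \<tau>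
  have G: "integrable lborel G"
    using g by (simp add: set_integrable_def G_def[abs_def])
  then have [measurable]: "G \<in> borel_measurable borel" by auto
  have coord: "H \<tau> \<bullet> e n = (indicator {0..t} \<tau> * exp (- \<mu> n * (t - \<tau>))) * (G \<tau> \<bullet> e n)" for \<tau> n
    using t by (auto simp: H_def G_def indicator_def eigenbasis_semigroup_inner[OF E e])
  have "integrable lborel H"
  proof (rule Bochner_Integration.integrable_bound[OF G])
    show "H \<in> borel_measurable lborel"
      by (rule borel_measurable_coordinates[OF onb]) (simp add: coord)
    have "norm (H \<tau>) \<le> norm (G \<tau>)" for \<tau>
      using t eigenbasis_semigroup_contraction[OF E e]
      by (auto simp: H_def G_def indicator_def)
    then show "AE \<tau> in lborel. norm (H \<tau>) \<le> norm (G \<tau>)" by simp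
  qed
  then have "has_bochner_integral lborel (\<lambda>\<tau>. H \<tau> \<bullet> e n) (integral\<^sup>L lborel H \<bullet> e n)"
    by (intro has_bochner_integral_inner_left has_bochner_integral_integrable)
  then show ?thesis
    unfolding coord by (simp add: G_def H_def[abs_def] set_lebesgue_integral_def)
qed

text \<open>In each coordinate Cauchy-Schwarz in time separates the kernel difference from
  \<open>g\<close>; the weight cancels the kernel bound, and Parseval under the integral reassembles
  the norm of \<open>g\<close>.\<close>

lemma drift_increment_le:
  fixes E :: "real \<Rightarrow> 'h::{real_inner, banach, second_countable_topology} \<Rightarrow> 'h"
  assumes E: "generated_by_minus A E" and e: "eigenbasis A e \<mu>"
    and t: "0 \<le> t1" "t1 \<le> t2" and g: "set_integrable lborel {0..t2} g"
  shows "(\<Sum>n. ennreal ((((LINT \<tau>:{0..t2}|lborel. E (t2 - \<tau>) (g \<tau>))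
        - (LINT \<tau>:{0..t1}|lborel. E (t1 - \<tau>) (g \<tau>))) \<bullet> e n / (1 + \<mu> n))\<^sup>2))
    \<le> ennreal ((t2 - t1)\<^sup>2 * t1 + (t2 - t1)) * (\<integral>\<^sup>+\<tau>\<in>{0..t2}. ennreal ((norm (g \<tau>))\<^sup>2) \<partial>lborel)"
proof -
  have onb: "orthonormal_basis e" and \<mu>: "\<And>n. 0 < \<mu> n"
    using e by (auto simp: eigenbasis_def)
  define G where "G \<tau> = indicator {0..t2} \<tau> *\<^sub>R g \<tau>" for \<tau>
  have "integrable lborel G"
    using g by (simp add: set_integrable_def G_def[abs_def])
  then have [measurable]: "G \<in> borel_measurable borel" by auto
  define D where "D t = (LINT \<tau>:{0..t}|lborel. E (t - \<tau>) (g \<tau>))" for t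
  define r where "r = (t2 - t1)\<^sup>2 * t1 + (t2 - t1)"
  have r: "0 \<le> r" using t by (simp add: r_def)
  have *: "ennreal (((D t2 - D t1) \<bullet> e n / (1 + \<mu> n))\<^sup>2) \<le> ennreal r * (\<integral>\<^sup>+\<tau>. ennreal ((G \<tau> \<bullet> e n)\<^sup>2) \<partial>lborel)" for n
  proof -
    define k where "k \<tau> = indicator {0..t2} \<tau> * exp (- \<mu> n * (t2 - \<tau>))
        - indicator {0..t1} \<tau> * exp (- \<mu> n * (t1 - \<tau>))" for \<tau>
    have [measurable]: "k \<in> borel_measurable borel" unfolding k_def by measurable
    have "has_bochner_integral lborel (\<lambda>\<tau>. k \<tau> * (G \<tau> \<bullet> e n)) (D t2 \<bullet> e n - D t1 \<bullet> e n)"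
      using has_bochner_integral_diff[OF semigroup_convolution_inner[OF E e _ _ g, of t2 n]
          semigroup_convolution_inner[OF E e _ _ g, of t1 n]] t
      by (simp add: k_def G_def D_def left_diff_distrib)
    then have "ennreal (norm ((D t2 - D t1) \<bullet> e n)) \<le> (\<integral>\<^sup>+\<tau>. ennreal (norm (k \<tau> * (G \<tau> \<bullet> e n))) \<partial>lborel)"
      using integral_norm_bound_ennreal[of lborel "\<lambda>\<tau>. k \<tau> * (G \<tau> \<bullet> e n)"]
      by (simp add: has_bochner_integral_iff inner_diff_left)
    also have "\<dots> = (\<integral>\<^sup>+\<tau>. ennreal \<bar>k \<tau>\<bar> * ennreal \<bar>G \<tau> \<bullet> e n\<bar> \<partial>lborel)"
      by (simp add: abs_mult ennreal_mult)
    finally have "(ennreal \<bar>(D t2 - D t1) \<bullet> e n\<bar>)\<^sup>2 \<le> (\<integral>\<^sup>+\<tau>. ennreal \<bar>k \<tau>\<bar> * ennreal \<bar>G \<tau> \<bullet> e n\<bar> \<partial>lborel)\<^sup>2"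
      by (intro power_mono) auto
    also have "\<dots> \<le> (\<integral>\<^sup>+\<tau>. (ennreal \<bar>k \<tau>\<bar>)\<^sup>2 \<partial>lborel) * (\<integral>\<^sup>+\<tau>. (ennreal \<bar>G \<tau> \<bullet> e n\<bar>)\<^sup>2 \<partial>lborel)"
      by (intro Cauchy_Schwarz_nn_integral) simp_all
    also have "\<dots> = (\<integral>\<^sup>+\<tau>. ennreal ((k \<tau>)\<^sup>2) \<partial>lborel) * (\<integral>\<^sup>+\<tau>. ennreal ((G \<tau> \<bullet> e n)\<^sup>2) \<partial>lborel)"
      by (simp add: ennreal_power)
    also have "\<dots> \<le> ennreal ((1 + \<mu> n)\<^sup>2 * r) * (\<integral>\<^sup>+\<tau>. ennreal ((G \<tau> \<bullet> e n)\<^sup>2) \<partial>lborel)"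
      unfolding k_def r_def by (intro mult_right_mono convolution_kernel_diff_integral_le t \<mu>) simp
    finally have le: "ennreal (((D t2 - D t1) \<bullet> e n)\<^sup>2)
        \<le> ennreal ((1 + \<mu> n)\<^sup>2 * r) * (\<integral>\<^sup>+\<tau>. ennreal ((G \<tau> \<bullet> e n)\<^sup>2) \<partial>lborel)"
      by (simp add: ennreal_power)
    have "ennreal (((D t2 - D t1) \<bullet> e n / (1 + \<mu> n))\<^sup>2)
        = ennreal (1 / (1 + \<mu> n)\<^sup>2) * ennreal (((D t2 - D t1) \<bullet> e n)\<^sup>2)"
      by (simp add: ennreal_mult[symmetric] power_divide)
    also have "\<dots> \<le> ennreal (1 / (1 + \<mu> n)\<^sup>2) * (ennreal ((1 + \<mu> n)\<^sup>2 * r) * (\<integral>\<^sup>+\<tau>. ennreal ((G \<tau> \<bullet> e n)\<^sup>2) \<partial>lborel))"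
      by (intro mult_left_mono le) simp
    also have "\<dots> = ennreal (1 / (1 + \<mu> n)\<^sup>2 * ((1 + \<mu> n)\<^sup>2 * r)) * (\<integral>\<^sup>+\<tau>. ennreal ((G \<tau> \<bullet> e n)\<^sup>2) \<partial>lborel)"
      using r by (simp add: ennreal_mult[symmetric] mult.assoc[symmetric])
    also have "1 / (1 + \<mu> n)\<^sup>2 * ((1 + \<mu> n)\<^sup>2 * r) = r"
      using \<mu>[of n] by (simp add: add_pos_pos less_imp_neq[THEN not_sym])
    finally show ?thesis .
  qed
  have "(\<Sum>n. ennreal (((D t2 - D t1) \<bullet> e n / (1 + \<mu> n))\<^sup>2))
      \<le> (\<Sum>n. ennreal r * (\<integral>\<^sup>+\<tau>. ennreal ((G \<tau> \<bullet> e n)\<^sup>2) \<partial>lborel))"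
    by (intro suminf_le * summableI)
  also have "\<dots> = ennreal r * (\<integral>\<^sup>+\<tau>. (\<Sum>n. ennreal ((G \<tau> \<bullet> e n)\<^sup>2)) \<partial>lborel)"
    by (simp add: ennreal_suminf_cmult nn_integral_suminf)
  also have "(\<integral>\<^sup>+\<tau>. (\<Sum>n. ennreal ((G \<tau> \<bullet> e n)\<^sup>2)) \<partial>lborel) = (\<integral>\<^sup>+\<tau>\<in>{0..t2}. ennreal ((norm (g \<tau>))\<^sup>2) \<partial>lborel)"
    unfolding parseval[OF onb] by (intro nn_integral_cong) (simp add: G_def indicator_def)
  finally show ?thesis by (simp add: D_def r_def)
qed

lemma initial_increment_le:
  fixes E :: "real \<Rightarrow> 'h::{real_inner, banach} \<Rightarrow> 'h"
  assumes E: "generated_by_minus A E" and e: "eigenbasis A e \<mu>" and t: "0 \<le> t1" "t1 \<le> t2"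
  shows "(\<Sum>n. ennreal (((E t2 x - E t1 x) \<bullet> e n / (1 + \<mu> n))\<^sup>2))
    \<le> ennreal ((t2 - t1)\<^sup>2) * ennreal ((norm x)\<^sup>2)"
proof -
  have onb: "orthonormal_basis e" and \<mu>: "\<And>n. 0 < \<mu> n"
    using e by (auto simp: eigenbasis_def)
  have *: "((E t2 x - E t1 x) \<bullet> e n / (1 + \<mu> n))\<^sup>2 \<le> (t2 - t1)\<^sup>2 * (x \<bullet> e n)\<^sup>2" for n
  proof -
    have "((exp (- \<mu> n * t2) - exp (- \<mu> n * t1)) / (1 + \<mu> n))\<^sup>2 \<le> (t2 - t1)\<^sup>2"
      using \<mu>[of n] exp_decay_diff_square_le[OF t \<mu>[of n]]
      by (simp add: power_divide divide_le_eq mult.commute)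
    then have "((exp (- \<mu> n * t2) - exp (- \<mu> n * t1)) / (1 + \<mu> n))\<^sup>2 * (x \<bullet> e n)\<^sup>2 \<le> (t2 - t1)\<^sup>2 * (x \<bullet> e n)\<^sup>2"
      by (rule mult_right_mono) simp
    moreover have "(E t2 x - E t1 x) \<bullet> e n / (1 + \<mu> n)
        = (exp (- \<mu> n * t2) - exp (- \<mu> n * t1)) / (1 + \<mu> n) * (x \<bullet> e n)"
      using t by (simp add: inner_diff_left eigenbasis_semigroup_inner[OF E e] left_diff_distrib)
    ultimately show ?thesis by (simp only: power_mult_distrib)
  qed
  have "(\<Sum>n. ennreal (((E t2 x - E t1 x) \<bullet> e n / (1 + \<mu> n))\<^sup>2))
      \<le> (\<Sum>n. ennreal ((t2 - t1)\<^sup>2) * ennreal ((x \<bullet> e n)\<^sup>2))"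
    by (intro suminf_le summableI) (simp add: ennreal_mult[symmetric] ennreal_leI *)
  then show ?thesis
    by (simp add: ennreal_suminf_cmult parseval[OF onb])
qed

text \<open>A function that is not integrable has integral 0 by convention, so the bound can be
  applied pathwise with no prior check.\<close>

lemma norm_integral_le_nn_integral:
  fixes g :: "'x \<Rightarrow> 'b::{banach, second_countable_topology}"
  shows "ennreal (norm (integral\<^sup>L N g)) \<le> (\<integral>\<^sup>+x. ennreal (norm (g x)) \<partial>N)"
  by (cases "integrable N g")
    (auto simp: integral_norm_bound_ennreal not_integrable_integral_eq)

section \<open>The mild solution in the coordinates of the eigenbasis\<close>

locale spectral_mild_solution = wiener M F Q W
  for M :: "'w measure" and F
    and Q :: "'h::{real_inner, banach, second_countable_topology} \<Rightarrow> 'h" and W +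
  fixes A :: "('h \<times> 'h) set" and E :: "real \<Rightarrow> 'h \<Rightarrow> 'h"
    and e :: "nat \<Rightarrow> 'h" and \<mu> :: "nat \<Rightarrow> real"
    and f :: "'h \<Rightarrow> 'h" and K :: real
    and v0 :: "'w \<Rightarrow> 'h" and u v :: "real \<Rightarrow> 'w \<Rightarrow> 'h"
  assumes E: "generated_by_minus A E" and e: "eigenbasis A e \<mu>"
    and trace: "pos_trace Q < \<infinity>"
    and K: "K > 0" and lipschitz: "\<And>x y. norm (f x - f y) \<le> K * norm (x - y)"
    and v0_measurable [measurable]: "v0 \<in> borel_measurable M"
    and v0_L2: "integrable M (\<lambda>\<omega>. (norm (v0 \<omega>))\<^sup>2)"
    and solution: "mild_solution M F A E f Q W v0 u v"
begin

lemma onb: "orthonormal_basis e" and \<mu>_pos: "0 < \<mu> n"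
  using e by (auto simp: eigenbasis_def)

lemma v_inner: "0 \<le> t \<Longrightarrow> \<omega> \<in> space M \<Longrightarrow> v t \<omega> \<bullet> e n = (1 + \<mu> n) * (u t \<omega> \<bullet> e n)"
  using solution by (intro eigenbasis_resolvent_inner[OF E e]) (auto simp: mild_solution_def)

lemma u_inner: "0 \<le> t \<Longrightarrow> \<omega> \<in> space M \<Longrightarrow> u t \<omega> \<bullet> e n = (v t \<omega> \<bullet> e n) / (1 + \<mu> n)"
  using v_inner[of t \<omega> n] \<mu>_pos[of n] by simp

lemma norm_u_le: 
  assumes "0 \<le> t" "\<omega> \<in> space M"
  shows "norm (u t \<omega>) \<le> norm (v t \<omega>)"
proof -
  have "(u t \<omega> \<bullet> e n)\<^sup>2 \<le> (v t \<omega> \<bullet> e n)\<^sup>2" for n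
    unfolding v_inner[OF assms] power_mult_distrib
    using \<mu>_pos[of n] mult_right_mono[of 1 "(1 + \<mu> n)\<^sup>2" "(u t \<omega> \<bullet> e n)\<^sup>2"] by simp
  then have "(\<Sum>n. ennreal ((u t \<omega> \<bullet> e n)\<^sup>2)) \<le> (\<Sum>n. ennreal ((v t \<omega> \<bullet> e n)\<^sup>2))"
    by (intro suminf_le summableI ennreal_leI)
  then show ?thesis
    by (simp add: parseval[OF onb])
qed

lemma f_measurable [measurable]: "f \<in> borel_measurable borel"
proof -
  have "K-lipschitz_on UNIV f"
    using K lipschitz by (auto simp: lipschitz_on_def dist_norm)
  then show ?thesis
    by (intro borel_measurable_continuous_onI lipschitz_on_continuous_on)
qed

text \<open>Measurability is given for \<open>v\<close> only; each coordinate of \<open>u\<close> is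
  a fixed multiple of that of \<open>v\<close>.\<close>

lemma u_measurable: "0 \<le> t \<Longrightarrow> u t \<in> borel_measurable M"
proof (rule borel_measurable_coordinates[OF onb])
  fix n assume t: "0 \<le> t"
  have [measurable]: "v t \<in> borel_measurable M"
    using solution t F_subalgebra unfolding mild_solution_def by (meson measurable_from_subalg)
  have "(\<lambda>\<omega>. (v t \<omega> \<bullet> e n) / (1 + \<mu> n)) \<in> borel_measurable M"
    by measurable
  then show "(\<lambda>\<omega>. u t \<omega> \<bullet> e n) \<in> borel_measurable M"
    using u_inner t by (simp cong: measurable_cong)
qed

lemma u_jointly_measurable: "(\<lambda>(t, \<omega>). u (max 0 t) \<omega>) \<in> borel_measurable (borel \<Otimes>\<^sub>M M)"
proof (rule borel_measurable_coordinates[OF onb])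
  fix n
  have v: "(\<lambda>(t, \<omega>). v t \<omega>) \<in> borel_measurable (restrict_space borel {0..} \<Otimes>\<^sub>M M)"
    using solution by (simp add: mild_solution_def)
  have "(\<lambda>(t, \<omega>). (max 0 t, \<omega>)) \<in> (borel \<Otimes>\<^sub>M M) \<rightarrow>\<^sub>M (restrict_space borel {0::real..} \<Otimes>\<^sub>M M)"
    unfolding split_def
    by (intro measurable_Pair measurable_restrict_space2) auto
  from measurable_compose[OF this v]
  have [measurable]: "(\<lambda>p. v (max 0 (fst p)) (snd p)) \<in> borel_measurable (borel \<Otimes>\<^sub>M M)"
    by (simp add: split_def)
  have "(\<lambda>p. (v (max 0 (fst p)) (snd p) \<bullet> e n) / (1 + \<mu> n)) \<in> borel_measurable (borel \<Otimes>\<^sub>M M)"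
    by measurable
  then show "(\<lambda>p. (case p of (t, \<omega>) \<Rightarrow> u (max 0 t) \<omega>) \<bullet> e n) \<in> borel_measurable (borel \<Otimes>\<^sub>M M)"
    by (rule measurable_cong[THEN iffD1, rotated])
      (auto simp: u_inner space_pair_measure)
qed

text \<open>The maximum with \<open>0\<close> keeps the time argument in the range where \<open>u\<close> is constrained.\<close>

definition f_norm :: "real \<Rightarrow> 'w \<Rightarrow> ennreal" where
  "f_norm t \<omega> = ennreal (norm (f (u (max 0 t) \<omega>)))"

lemma f_norm_measurable: "(\<lambda>(t, \<omega>). f_norm t \<omega>) \<in> borel_measurable (borel \<Otimes>\<^sub>M M)"
proof -
  note [measurable] = u_jointly_measurable
  show ?thesis
    unfolding f_norm_def by measurable
qed

text \<open>The Lipschitz condition at 0 gives linear growth of \<open>f\<close>. The bound is in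
  terms of \<open>v\<close>, for which the mild formula is stated.\<close>

lemma f_norm_le:
  assumes "0 \<le> t" "\<omega> \<in> space M"
  shows "f_norm t \<omega> \<le> ennreal (norm (f 0) + K * norm (v t \<omega>))"
proof -
  have "norm (f (u t \<omega>)) \<le> norm (f 0) + norm (f (u t \<omega>) - f 0)"
    by (metis add.commute diff_add_cancel norm_triangle_ineq)
  also have "norm (f (u t \<omega>) - f 0) \<le> K * norm (u t \<omega>)"
    using lipschitz[of "u t \<omega>" 0] by simp
  also have "\<dots> \<le> K * norm (v t \<omega>)"
    using K norm_u_le[OF assms] by simp
  finally show ?thesis
    using assms by (simp add: f_norm_def max_def ennreal_leI)
qed

lemma mild_solution_formula:
  obtains Z where "\<And>t. 0 \<le> t \<Longrightarrow> has_wiener_integral M Q W (\<lambda>\<tau>. E (t - \<tau>)) t (Z t)"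
    and "AE \<omega> in M. \<forall>t\<ge>0. set_integrable lborel {0..t} (\<lambda>\<tau>. f (u \<tau> \<omega>)) \<and>
      v t \<omega> = E t (v0 \<omega>) + (LINT \<tau>:{0..t}|lborel. E (t - \<tau>) (f (u \<tau> \<omega>))) + Z t \<omega>"
  using solution unfolding mild_solution_def by blast

text \<open>The mild formula makes \<open>f_norm\<close> satisfy a pathwise Volterra inequality
  whose inhomogeneity, built from \<open>f 0\<close>, \<open>v0\<close> and \<open>Z t\<close>, has
  bounded second moments. The unknown is the norm of \<open>f (u t \<omega>)\<close> rather than of
  \<open>u t \<omega>\<close> because pathwise integrability, which Gronwall's inequality requires,
  is part of the definition of a mild solution for the former.\<close>

lemma f_norm_square_integrable:
  assumes T: "T \<ge> 0"
  shows "(\<integral>\<^sup>+\<omega>. (\<integral>\<^sup>+t\<in>{0..T}. (f_norm t \<omega>)\<^sup>2 \<partial>lborel) \<partial>M) < \<infinity>"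
proof -
  obtain Z where Z: "\<And>t. 0 \<le> t \<Longrightarrow> has_wiener_integral M Q W (\<lambda>\<tau>. E (t - \<tau>)) t (Z t)"
    and formula: "AE \<omega> in M. \<forall>t\<ge>0. set_integrable lborel {0..t} (\<lambda>\<tau>. f (u \<tau> \<omega>)) \<and>
      v t \<omega> = E t (v0 \<omega>) + (LINT \<tau>:{0..t}|lborel. E (t - \<tau>) (f (u \<tau> \<omega>))) + Z t \<omega>"
    by (rule mild_solution_formula) blast
  have Z_measurable [measurable]: "Z t \<in> borel_measurable M" if "0 \<le> t" for t
    using Z[OF that] by (simp add: has_wiener_integral_def)
  define V where "V = (\<integral>\<^sup>+\<omega>. ennreal ((norm (v0 \<omega>))\<^sup>2) \<partial>M)"
  have V: "V < \<infinity>"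
    using v0_L2 by (simp add: V_def integrable_iff_bounded)
  define C where "C = 4 * ennreal ((norm (f 0))\<^sup>2) + 4 * ennreal (K\<^sup>2) * V
    + 2 * ennreal (K\<^sup>2) * (4 * ennreal T * pos_trace Q)"
  show ?thesis
  proof (rule expected_square_gronwall[OF prob_space_axioms f_norm_measurable K T])
    show "AE \<omega> in M. (\<integral>\<^sup>+t\<in>{0..T}. f_norm t \<omega> \<partial>lborel) < \<infinity>"
      using formula
    proof eventually_elim
      case (elim \<omega>)
      then have "set_integrable lborel {0..T} (\<lambda>\<tau>. f (u \<tau> \<omega>))" using T by blast
      then have "(\<integral>\<^sup>+t. ennreal (norm (indicator {0..T} t *\<^sub>R f (u t \<omega>))) \<partial>lborel) < \<infinity>"
        unfolding set_integrable_def integrable_iff_bounded by blast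
      also have "(\<integral>\<^sup>+t. ennreal (norm (indicator {0..T} t *\<^sub>R f (u t \<omega>))) \<partial>lborel)
          = (\<integral>\<^sup>+t\<in>{0..T}. f_norm t \<omega> \<partial>lborel)"
        by (intro nn_integral_cong) (simp add: indicator_def f_norm_def max_def)
      finally show ?case .
    qed
    show "C < \<infinity>"
      using V trace by (simp add: C_def ennreal_mult_less_top)
    fix t assume t: "0 \<le> t" "t \<le> T"
    have "AE \<omega> in M. f_norm t \<omega> - ennreal K * (\<integral>\<^sup>+s\<in>{0..t}. f_norm s \<omega> \<partial>lborel)
        \<le> ennreal (norm (f 0) + K * norm (v0 \<omega>) + K * norm (Z t \<omega>))"
      using formula AE_space
    proof eventually_elim
      case (elim \<omega>)
      define I where "I = (LINT \<tau>:{0..t}|lborel. E (t - \<tau>) (f (u \<tau> \<omega>)))"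
      have "ennreal (norm I) \<le> (\<integral>\<^sup>+\<tau>. ennreal (norm (indicator {0..t} \<tau> *\<^sub>R E (t - \<tau>) (f (u \<tau> \<omega>)))) \<partial>lborel)"
        unfolding I_def set_lebesgue_integral_def by (rule norm_integral_le_nn_integral)
      also have "\<dots> \<le> (\<integral>\<^sup>+s\<in>{0..t}. f_norm s \<omega> \<partial>lborel)"
        using eigenbasis_semigroup_contraction[OF E e]
        by (intro nn_integral_mono) (auto simp: indicator_def f_norm_def max_def intro!: ennreal_leI)
      finally have I: "ennreal (norm I) \<le> (\<integral>\<^sup>+s\<in>{0..t}. f_norm s \<omega> \<partial>lborel)" .
      have "norm (v t \<omega>) \<le> norm (E t (v0 \<omega>)) + norm I + norm (Z t \<omega>)"
        using elim(1) t(1) by (metis I_def norm_triangle_mono norm_triangle_ineq order_refl)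
      also have "norm (E t (v0 \<omega>)) \<le> norm (v0 \<omega>)"
        by (rule eigenbasis_semigroup_contraction[OF E e t(1)])
      finally have "norm (f 0) + K * norm (v t \<omega>)
          \<le> norm (f 0) + K * (norm (v0 \<omega>) + norm I + norm (Z t \<omega>))"
        using K by simp
      also have "\<dots> = K * norm I + (norm (f 0) + K * norm (v0 \<omega>) + K * norm (Z t \<omega>))"
        by (simp add: algebra_simps)
      finally have "ennreal (norm (f 0) + K * norm (v t \<omega>))
          \<le> ennreal (K * norm I + (norm (f 0) + K * norm (v0 \<omega>) + K * norm (Z t \<omega>)))"
        by (rule ennreal_leI)
      also have "\<dots> = ennreal (K * norm I) + ennreal (norm (f 0) + K * norm (v0 \<omega>) + K * norm (Z t \<omega>))"
        using K by (intro ennreal_plus) auto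
      also have "ennreal (K * norm I) = ennreal K * ennreal (norm I)"
        using K by (intro ennreal_mult) auto
      also have "\<dots> \<le> ennreal K * (\<integral>\<^sup>+s\<in>{0..t}. f_norm s \<omega> \<partial>lborel)"
        by (intro mult_left_mono I) simp
      finally have "f_norm t \<omega> \<le> ennreal K * (\<integral>\<^sup>+s\<in>{0..t}. f_norm s \<omega> \<partial>lborel)
          + ennreal (norm (f 0) + K * norm (v0 \<omega>) + K * norm (Z t \<omega>))"
        using f_norm_le[OF t(1) elim(2)] by (meson add_right_mono order_trans)
      \<comment> \<open>Moving the Volterra term to the left is valid because
        \<open>f_norm t \<omega>\<close> is finite, being the image of a real number.\<close>
      then show ?case
        by (simp add: ennreal_minus_le_iff) (simp add: f_norm_def)
    qed
    then have "(\<integral>\<^sup>+\<omega>. (f_norm t \<omega> - ennreal K * (\<integral>\<^sup>+s\<in>{0..t}. f_norm s \<omega> \<partial>lborel))\<^sup>2 \<partial>M)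
        \<le> (\<integral>\<^sup>+\<omega>. 4 * ennreal ((norm (f 0))\<^sup>2) + 4 * ennreal (K\<^sup>2) * ennreal ((norm (v0 \<omega>))\<^sup>2)
            + 2 * ennreal (K\<^sup>2) * ennreal ((norm (Z t \<omega>))\<^sup>2) \<partial>M)"
    proof (intro nn_integral_mono_AE, eventually_elim)
      case (elim \<omega>)
      have "(f_norm t \<omega> - ennreal K * (\<integral>\<^sup>+s\<in>{0..t}. f_norm s \<omega> \<partial>lborel))\<^sup>2
          \<le> (ennreal (norm (f 0) + K * norm (v0 \<omega>) + K * norm (Z t \<omega>)))\<^sup>2"
        using elim(2) by (rule power_mono) simp
      also have "\<dots> = ennreal ((norm (f 0) + K * norm (v0 \<omega>) + K * norm (Z t \<omega>))\<^sup>2)"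
        using K by (intro ennreal_power) simp
      also have "\<dots> \<le> 4 * ennreal ((norm (f 0))\<^sup>2) + 4 * ennreal ((K * norm (v0 \<omega>))\<^sup>2)
          + 2 * ennreal ((K * norm (Z t \<omega>))\<^sup>2)"
        by (intro ennreal_le_combination3 power2_add3_le zero_le_power2)
      finally show ?case
        by (simp add: power_mult_distrib ennreal_mult mult.assoc)
    qed
    also have "\<dots> = 4 * ennreal ((norm (f 0))\<^sup>2) + 4 * ennreal (K\<^sup>2) * V
        + 2 * ennreal (K\<^sup>2) * (\<integral>\<^sup>+\<omega>. ennreal ((norm (Z t \<omega>))\<^sup>2) \<partial>M)"
      using t(1) by (simp add: nn_integral_add nn_integral_cmult V_def emeasure_space_1)
    also have "\<dots> \<le> C"
      unfolding C_def
    proof (intro add_left_mono mult_left_mono)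
      have "(\<integral>\<^sup>+\<omega>. ennreal ((norm (Z t \<omega>))\<^sup>2) \<partial>M) \<le> 4 * ennreal t * pos_trace Q"
        by (rule convolution_second_moment[OF E e t(1) Z[OF t(1)]])
      also have "\<dots> \<le> 4 * ennreal T * pos_trace Q"
        using t by (intro mult_right_mono mult_left_mono ennreal_leI) auto
      finally show "(\<integral>\<^sup>+\<omega>. ennreal ((norm (Z t \<omega>))\<^sup>2) \<partial>M) \<le> 4 * ennreal T * pos_trace Q" .
    qed simp
    finally show "(\<integral>\<^sup>+\<omega>. (f_norm t \<omega> - ennreal K * (\<integral>\<^sup>+s\<in>{0..t}. f_norm s \<omega> \<partial>lborel))\<^sup>2 \<partial>M) \<le> C" .
  qed
qed

text \<open>The formula for \<open>v\<close> holds on one almost sure event for all times, hence at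
  \<open>t1\<close> and \<open>t2\<close> together. Divided by \<open>1 + \<mu> n\<close>, it splits
  each coordinate of the increment of \<open>u\<close> into the three increments already
  estimated.\<close>

lemma increment_second_moment:
  assumes T: "T \<ge> 0"
  obtains C where "C \<ge> 0" "\<And>t1 t2. 0 \<le> t1 \<Longrightarrow> t1 \<le> t2 \<Longrightarrow> t2 \<le> T \<Longrightarrow>
    (\<integral>\<^sup>+\<omega>. ennreal ((norm (u t2 \<omega> - u t1 \<omega>))\<^sup>2) \<partial>M) \<le> ennreal (C * (t2 - t1))"
proof -
  interpret pair_sigma_finite lborel M ..
  obtain Z where Z: "\<And>t. 0 \<le> t \<Longrightarrow> has_wiener_integral M Q W (\<lambda>\<tau>. E (t - \<tau>)) t (Z t)"
    and formula: "AE \<omega> in M. \<forall>t\<ge>0. set_integrable lborel {0..t} (\<lambda>\<tau>. f (u \<tau> \<omega>)) \<and>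
      v t \<omega> = E t (v0 \<omega>) + (LINT \<tau>:{0..t}|lborel. E (t - \<tau>) (f (u \<tau> \<omega>))) + Z t \<omega>"
    by (rule mild_solution_formula) blast
  have [measurable]: "(\<lambda>(t, \<omega>). f_norm t \<omega>) \<in> borel_measurable (lborel \<Otimes>\<^sub>M M)"
    using f_norm_measurable by (simp cong: measurable_cong_sets sets_pair_measure_cong)
  define V where "V = (\<integral>\<^sup>+\<omega>. ennreal ((norm (v0 \<omega>))\<^sup>2) \<partial>M)"
  have V: "V < \<infinity>"
    using v0_L2 by (simp add: V_def integrable_iff_bounded)
  define S where "S = (\<integral>\<^sup>+\<omega>. (\<integral>\<^sup>+t\<in>{0..T}. (f_norm t \<omega>)\<^sup>2 \<partial>lborel) \<partial>M)"
  have S: "S < \<infinity>"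
    unfolding S_def by (rule f_norm_square_integrable[OF T])
  \<comment> \<open>Since \<open>t2 - t1\<close> and \<open>t1\<close> are at most \<open>T\<close>,
    the kernel bound \<open>h\<^sup>2 * t1 + h\<close> is at most \<open>(T\<^sup>2 + 1) * h\<close>
    for \<open>h = t2 - t1\<close>.\<close>
  define k where "k = T\<^sup>2 + 1"
  have k: "0 \<le> k" by (simp add: k_def)
  \<comment> \<open>The three-term weights 4, 4, 2 are combined with
    \<open>h\<^sup>2 \<le> T * h\<close> for the initial value and with \<open>r \<le> k * h\<close>
    for the other terms; \<open>8 = 2 * 4\<close> contains the constant 4 of the Wiener integral
    bound.\<close>
  define C where "C = ennreal (4 * T) * V + ennreal (4 * k) * S + ennreal (8 * k) * pos_trace Q"
  have C: "C < \<infinity>"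
    using V S trace by (simp add: C_def ennreal_mult_less_top)
  have main: "(\<integral>\<^sup>+\<omega>. ennreal ((norm (u t2 \<omega> - u t1 \<omega>))\<^sup>2) \<partial>M) \<le> C * ennreal (t2 - t1)"
    if t: "0 \<le> t1" "t1 \<le> t2" "t2 \<le> T" for t1 t2
  proof -
    have t2: "0 \<le> t2" using t by simp
    have [measurable]: "Z t1 \<in> borel_measurable M" "Z t2 \<in> borel_measurable M"
      using Z[OF t(1)] Z[OF t2] by (auto simp: has_wiener_integral_def)
    define h where "h = t2 - t1"
    define r where "r = h\<^sup>2 * t1 + h"
    have h: "0 \<le> h" "h \<le> T" using t by (auto simp: h_def)
    have r: "0 \<le> r" using h t by (simp add: r_def)
    have h2: "h\<^sup>2 \<le> T * h" using h by (simp add: power2_eq_square mult_right_mono)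
    have "h\<^sup>2 * t1 \<le> T * h * T"
      using h2 h t by (intro mult_mono) auto
    then have r_le: "r \<le> k * h"
      by (simp add: r_def k_def power2_eq_square algebra_simps)
    define Zs where "Zs \<omega> = (\<Sum>n. ennreal ((((Z t2 \<omega> - Z t1 \<omega>) \<bullet> e n) / (1 + \<mu> n))\<^sup>2))" for \<omega>
    have [measurable]: "Zs \<in> borel_measurable M" unfolding Zs_def by measurable
    define Fs where "Fs \<omega> = (\<integral>\<^sup>+t\<in>{0..T}. (f_norm t \<omega>)\<^sup>2 \<partial>lborel)" for \<omega>
    have [measurable]: "Fs \<in> borel_measurable M" unfolding Fs_def by measurable
    have "AE \<omega> in M. ennreal ((norm (u t2 \<omega> - u t1 \<omega>))\<^sup>2)
        \<le> 4 * (ennreal (h\<^sup>2) * ennreal ((norm (v0 \<omega>))\<^sup>2)) + 4 * (ennreal r * Fs \<omega>) + 2 * Zs \<omega>"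
      using formula AE_space
    proof eventually_elim
      case (elim \<omega>)
      define I where "I t = (LINT \<tau>:{0..t}|lborel. E (t - \<tau>) (f (u \<tau> \<omega>)))" for t
      define a where "a n = (E t2 (v0 \<omega>) - E t1 (v0 \<omega>)) \<bullet> e n / (1 + \<mu> n)" for n
      define b where "b n = (I t2 - I t1) \<bullet> e n / (1 + \<mu> n)" for n
      define c where "c n = (Z t2 \<omega> - Z t1 \<omega>) \<bullet> e n / (1 + \<mu> n)" for n
      have "(u t2 \<omega> - u t1 \<omega>) \<bullet> e n = a n + b n + c n" for n
      proof -
        have "(u t2 \<omega> - u t1 \<omega>) \<bullet> e n = (v t2 \<omega> - v t1 \<omega>) \<bullet> e n / (1 + \<mu> n)"
          using t(1) t2 elim(2) by (simp add: inner_diff_left u_inner diff_divide_distrib)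
        also have "v t2 \<omega> - v t1 \<omega> = (E t2 (v0 \<omega>) - E t1 (v0 \<omega>)) + (I t2 - I t1) + (Z t2 \<omega> - Z t1 \<omega>)"
          using elim(1) t(1) t2 by (simp add: I_def)
        finally show ?thesis
          by (simp only: a_def b_def c_def inner_add_left add_divide_distrib)
      qed
      then have "ennreal ((norm (u t2 \<omega> - u t1 \<omega>))\<^sup>2) = (\<Sum>n. ennreal ((a n + b n + c n)\<^sup>2))"
        by (simp add: parseval[OF onb, symmetric])
      also have "\<dots> \<le> (\<Sum>n. 4 * ennreal ((a n)\<^sup>2) + 4 * ennreal ((b n)\<^sup>2) + 2 * ennreal ((c n)\<^sup>2))"
        by (intro suminf_le summableI ennreal_le_combination3 power2_add3_le zero_le_power2)
      also have "\<dots> = 4 * (\<Sum>n. ennreal ((a n)\<^sup>2)) + 4 * (\<Sum>n. ennreal ((b n)\<^sup>2)) + 2 * (\<Sum>n. ennreal ((c n)\<^sup>2))"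
        by (simp add: suminf_add[symmetric] summableI ennreal_suminf_cmult)
      also have "\<dots> \<le> 4 * (ennreal (h\<^sup>2) * ennreal ((norm (v0 \<omega>))\<^sup>2)) + 4 * (ennreal r * Fs \<omega>) + 2 * Zs \<omega>"
      proof (intro add_mono mult_left_mono)
        show "(\<Sum>n. ennreal ((a n)\<^sup>2)) \<le> ennreal (h\<^sup>2) * ennreal ((norm (v0 \<omega>))\<^sup>2)"
          unfolding a_def h_def by (rule initial_increment_le[OF E e t(1,2)])
        have "(\<Sum>n. ennreal ((b n)\<^sup>2))
            \<le> ennreal r * (\<integral>\<^sup>+\<tau>\<in>{0..t2}. ennreal ((norm (f (u \<tau> \<omega>)))\<^sup>2) \<partial>lborel)"
          unfolding b_def I_def r_def h_def
          using elim(1) t2 by (intro drift_increment_le[OF E e t(1,2)]) blast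
        also have "\<dots> \<le> ennreal r * Fs \<omega>"
          unfolding Fs_def using t(3)
          by (intro mult_left_mono nn_integral_mono)
            (auto simp: indicator_def f_norm_def max_def ennreal_power)
        finally show "(\<Sum>n. ennreal ((b n)\<^sup>2)) \<le> ennreal r * Fs \<omega>" .
        show "(\<Sum>n. ennreal ((c n)\<^sup>2)) \<le> Zs \<omega>"
          by (simp add: c_def Zs_def)
      qed simp_all
      finally show ?case .
    qed
    then have "(\<integral>\<^sup>+\<omega>. ennreal ((norm (u t2 \<omega> - u t1 \<omega>))\<^sup>2) \<partial>M)
        \<le> (\<integral>\<^sup>+\<omega>. 4 * (ennreal (h\<^sup>2) * ennreal ((norm (v0 \<omega>))\<^sup>2)) + 4 * (ennreal r * Fs \<omega>) + 2 * Zs \<omega> \<partial>M)"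
      by (rule nn_integral_mono_AE)
    also have "\<dots> = 4 * (ennreal (h\<^sup>2) * V) + 4 * (ennreal r * S) + 2 * (\<integral>\<^sup>+\<omega>. Zs \<omega> \<partial>M)"
      by (simp add: nn_integral_add nn_integral_cmult V_def S_def Fs_def[symmetric])
    also have "\<dots> \<le> 4 * (ennreal (T * h) * V) + 4 * (ennreal (k * h) * S)
        + 2 * (4 * ennreal (k * h) * pos_trace Q)"
    proof (intro add_mono mult_left_mono mult_right_mono ennreal_leI h2 r_le)
      have "(\<integral>\<^sup>+\<omega>. Zs \<omega> \<partial>M) \<le> 4 * ennreal r * pos_trace Q"
        unfolding Zs_def r_def h_def
        by (rule convolution_increment_second_moment[OF E e t(1,2) Z[OF t(1)] Z[OF t2]])
      also have "\<dots> \<le> 4 * ennreal (k * h) * pos_trace Q"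
        by (intro mult_left_mono mult_right_mono ennreal_leI r_le) simp_all
      finally show "(\<integral>\<^sup>+\<omega>. Zs \<omega> \<partial>M) \<le> 4 * ennreal (k * h) * pos_trace Q" .
    qed simp_all
    also have "\<dots> = C * ennreal h"
    proof -
      have "4 * (ennreal (T * h) * V) = ennreal (4 * T) * V * ennreal h"
        using T h by (simp add: ennreal_mult mult_ac)
      moreover have "4 * (ennreal (k * h) * S) = ennreal (4 * k) * S * ennreal h"
        using h k by (simp add: ennreal_mult mult_ac)
      moreover have "2 * (4 * ennreal (k * h) * pos_trace Q) = ennreal (8 * k) * pos_trace Q * ennreal h"
        using h k by (simp add: ennreal_mult mult.assoc[symmetric]) (simp add: mult_ac)
      ultimately show ?thesis
        unfolding C_def by (simp only: distrib_right)
    qed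
    finally show ?thesis by (simp add: h_def)
  qed
  show ?thesis
  proof
    show "0 \<le> enn2real C" by simp
    fix t1 t2 assume t: "0 \<le> t1" "t1 \<le> t2" "t2 \<le> T"
    have "C = ennreal (enn2real C)" using C by simp
    then have "C * ennreal (t2 - t1) = ennreal (enn2real C * (t2 - t1))"
      using t by (metis diff_ge_0_iff_ge enn2real_nonneg ennreal_mult)
    with main[OF t] show "(\<integral>\<^sup>+\<omega>. ennreal ((norm (u t2 \<omega> - u t1 \<omega>))\<^sup>2) \<partial>M) \<le> ennreal (enn2real C * (t2 - t1))"
      by simp
  qed
qed

end

section \<open>From the linear rate to the exponent \<open>\<gamma>\<close>\<close>

theorem lemma2p4:
  fixes D :: "'a::euclidean_space set"
    and J :: "'h::{real_inner, banach, second_countable_topology} \<Rightarrow> 'a \<Rightarrow> real"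
    and A :: "('h \<times> 'h) set"
    and E :: "real \<Rightarrow> 'h \<Rightarrow> 'h"
    and M :: "'w measure"
    and F :: "real \<Rightarrow> 'w measure"
    and Q :: "'h \<Rightarrow> 'h"
    and W :: "real \<Rightarrow> 'w \<Rightarrow> 'h"
    and v0 :: "'w \<Rightarrow> 'h"
    and f :: "'h \<Rightarrow> 'h"
    and u v :: "real \<Rightarrow> 'w \<Rightarrow> 'h"
    and K_f C_f \<beta> \<gamma> T :: real
  assumes dim: "DIM('a) \<in> {1, 2, 3}"
    and domain: "convex_polytopal_domain D"
    and H: "is_L2 D J"
    and A: "A = dirichlet_op D J"
    and E: "generated_by_minus A E"
    and prob: "prob_space M"
    and filtration: "usual_filtration M F"
    and Q: "pos_trace_class Q"
    and W: "wiener_process M F Q W"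
    and v0_measurable: "v0 \<in> borel_measurable (F 0)"
    and v0_L2: "integrable M (\<lambda>\<omega>. (norm (v0 \<omega>))\<^sup>2)"
    and lipschitz: "\<And>x1 x2. norm (f x1 - f x2) \<le> K_f * norm (x1 - x2)"
    and beta: "0 \<le> \<beta>" "\<beta> \<le> 1"
    and growth: "\<And>x. \<exists>y. (f x, y) \<in> op_powr A ((\<beta> - 1) / 2) \<and> norm y \<le> C_f * norm x"
    and solution: "mild_solution M F A E f Q W v0 u v"
    and T: "0 < T"
    and gamma: "0 \<le> \<gamma>" "\<gamma> < \<beta>"
  shows "\<exists>C. \<forall>t1 t2. 0 \<le> t1 \<and> t1 \<le> t2 \<and> t2 \<le> T \<longrightarrow>
           integrable M (\<lambda>\<omega>. (norm (u t2 \<omega> - u t1 \<omega>))\<^sup>2) \<and>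
           prob_space.expectation M (\<lambda>\<omega>. (norm (u t2 \<omega> - u t1 \<omega>))\<^sup>2) \<le> C * (t2 - t1) powr \<gamma>"
proof -
  \<comment> \<open>Membership in the graph \<open>op_powr\<close> includes the existence of an
    eigenbasis, so one instance suffices; the vector 0 is an arbitrary choice.\<close>
  obtain e \<mu> where e: "eigenbasis A e \<mu>"
    using growth[of 0] unfolding op_powr_def by blast
  have "subalgebra M (F 0)"
    using filtration by (simp add: usual_filtration_def)
  then have v0: "v0 \<in> borel_measurable M"
    using v0_measurable by (rule measurable_from_subalg)
  \<comment> \<open>Enlarging the constant makes it positive, as the weight in Gronwall's inequality
    requires.\<close>
  have lip: "norm (f x - f y) \<le> max K_f 1 * norm (x - y)" for x y
    using lipschitz[of x y] by (rule order_trans) (intro mult_right_mono, auto)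
  interpret prob_space M by (rule prob)
  interpret spectral_mild_solution M F Q W A E e \<mu> f "max K_f 1" v0 u v
    by unfold_locales
      (use filtration Q W E e lip v0 v0_L2 solution in \<open>auto simp: pos_trace_class_def\<close>)
  obtain C where C: "C \<ge> 0" "\<And>t1 t2. 0 \<le> t1 \<Longrightarrow> t1 \<le> t2 \<Longrightarrow> t2 \<le> T \<Longrightarrow>
      (\<integral>\<^sup>+\<omega>. ennreal ((norm (u t2 \<omega> - u t1 \<omega>))\<^sup>2) \<partial>M) \<le> ennreal (C * (t2 - t1))"
    using increment_second_moment[of T] T by auto
  show ?thesis
  proof (intro exI allI impI, elim conjE)
    fix t1 t2 :: real
    assume t: "0 \<le> t1" "t1 \<le> t2" "t2 \<le> T"
    have [measurable]: "u t1 \<in> borel_measurable M" "u t2 \<in> borel_measurable M"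
      using t by (auto intro: u_measurable)
    note le = C(2)[OF t]
    have int: "integrable M (\<lambda>\<omega>. (norm (u t2 \<omega> - u t1 \<omega>))\<^sup>2)"
      using le by (intro integrableI_bounded) (auto intro: le_less_trans)
    have "ennreal (expectation (\<lambda>\<omega>. (norm (u t2 \<omega> - u t1 \<omega>))\<^sup>2)) \<le> ennreal (C * (t2 - t1))"
      using le by (simp add: nn_integral_eq_integral[OF int])
    then have "expectation (\<lambda>\<omega>. (norm (u t2 \<omega> - u t1 \<omega>))\<^sup>2) \<le> C * (t2 - t1)"
      using C(1) t by (simp add: ennreal_le_iff)
    \<comment> \<open>The exponent \<open>1 - \<gamma>\<close> is positive because
      \<open>\<gamma> < \<beta> \<le> 1\<close>, so its power is bounded by that of
      \<open>T\<close>. For \<open>t1 = t2\<close> both sides are 0, even if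
      \<open>\<gamma> = 0\<close>, since \<open>0 powr 0 = 0\<close>.\<close>
    also have "t2 - t1 = (t2 - t1) powr (1 - \<gamma>) * (t2 - t1) powr \<gamma>"
      using t by (simp add: powr_add[symmetric])
    also have "C * \<dots> \<le> C * (T powr (1 - \<gamma>) * (t2 - t1) powr \<gamma>)"
      using C(1) t beta gamma by (intro mult_left_mono mult_right_mono powr_mono2) auto
    finally show "integrable M (\<lambda>\<omega>. (norm (u t2 \<omega> - u t1 \<omega>))\<^sup>2) \<and>
        expectation (\<lambda>\<omega>. (norm (u t2 \<omega> - u t1 \<omega>))\<^sup>2) \<le> C * T powr (1 - \<gamma>) * (t2 - t1) powr \<gamma>"
      using int by (simp add: mult.assoc)
  qed
qed

end
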